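(* Let $R\in\mathcal L(BC(\mathbb R;\mathbb R^n))$. Let $a^*,b^*,q$ satisfy the assumptions (L) stated in the context, and let one of the conditions (B1) and (B2) stated in the context be fulfilled. Then, for any $g\in BC(\Pi;\mathbb R^n)$ and $h\in BC(\mathbb R;\mathbb R^n)$, the linear problem (LP) described in the context has a unique bounded continuous solution $v$. Moreover, the a priori estimate $$\|v\|_{BC}\le K\bigl(\|g\|_{BC}+\|h\|_{BC}\bigr)$$ is fulfilled for a constant $K>0$ not depending on $g$ and $h$.
   Context: **Function spaces.** $\Pi=\{(x,t)\in\mathbb R^2:0\le x\le1\}$. $BC(\Pi;\mathbb R^n)$ is the Banach space of bounded continuous maps $u:\Pi\to\mathbb R^n$ with $\|u\|_{BC}=\sup\{|u_j(x,t)|:(x,t)\in\Pi,\ j\le n\}$; $BC^1(\Pi;\mathbb R^n)$ is the space of continuously differentiable maps that are bounded together with their first-order derivatives. $BC(\mathbb R;\mathbb R^n)$ is defined analogously; for $n=1$ write $BC(\Pi)$, $BC^1(\Pi)$, $BC(\mathbb R)$. $\mathcal L(X)$ is the space of bounded linear operators on $X$. **Assumptions (L).** $a^*=(a^*_{jk})$, $b^*=(b^*_{jk})$ are $n\times n$ matrices of real-valued functions with $a^*_{jk}\in BC^1(\Pi)$, $b^*_{jk}\in BC(\Pi)$. The matrix $a^*(x,t)$ has $n$ real eigenvalues $a_1(x,t)>\dots>a_m(x,t)>0>a_{m+1}(x,t)>\dots>a_n(x,t)$ for some integer $0\le m\le n$. $q=(q_{jk})$ is a nondegenerate $n\times n$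 matrix with $q_{jk}\in BC^1(\Pi)$ and $a:=q^{-1}a^*q=\operatorname{diag}(a_1,\dots,a_n)$. There is $\lambda_0>0$ such that $\inf_\Pi a_j>\lambda_0$ for $1\le j\le m$, $\sup_\Pi a_j<-\lambda_0$ for $m<j\le n$, $\inf_\Pi|a_j-a_k|>\lambda_0$ for $1\le j\ne k\le n$, and $\inf_\Pi|\det q|>\lambda_0$. **Problem (LP).** The unknown is $v$: $$\partial_tv+a^*(x,t)\partial_xv+b^*(x,t)v=g(x,t),\qquad x\in(0,1),\ t\in\mathbb R,$$ $$u_j(0,t)=(Rz)_j(t)+h_j(t),\ 1\le j\le m;\qquad u_j(1,t)=(Rz)_j(t)+h_j(t),\ m<j\le n;\qquad t\in\mathbb R,$$ where $u=q^{-1}v$ and $z(t)=(u_1(1,t),\dots,u_m(1,t),u_{m+1}(0,t),\dots,u_n(0,t))$. **Notation.** $b=q^{-1}(b^*q+\partial_tq+a^*\partial_xq)$. For $(x,t)\in\Pi$, $\xi\in[0,1]\mapsto\omega_j(\xi)=\omega_j(\xi,x,t)$ solves $\partial_\xi\omega_j(\xi,x,t)=1/a_j(\xi,\omega_j(\xi,x,t))$, $\omega_j(x,x,t)=t$. Put $x_j=0$ for $1\le j\le m$, $x_j=1$ for $m<j\le n$, and $$c_j(\xi,x,t)=\exp\int_x^\xi\Bigl[\frac{b_{jj}}{a_j}\Bigr](\eta,\omega_j(\eta,x,t))\,d\eta,\qquad d_j(\xi,x,t)=\frac{c_j(\xi,x,t)}{a_j(\xi,\omega_j(\xi,x,t))}.$$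 **Bounded continuous solution.** A function $v\in BC(\Pi;\mathbb R^n)$ is a bounded continuous solution to (LP) if $u=q^{-1}v$ satisfies, for all $j\le n$ and all $(x,t)\in\Pi$, $$u_j(x,t)=c_j(x_j,x,t)\bigl[(Rz)_j(\omega_j(x_j))+h_j(\omega_j(x_j))\bigr]-\int_{x_j}^xd_j(\xi,x,t)\Bigl(\sum_{k\ne j}b_{jk}(\xi,\omega_j(\xi))u_k(\xi,\omega_j(\xi))-(q^{-1}g)_j(\xi,\omega_j(\xi))\Bigr)d\xi .$$ **Conditions.** Put $$\gamma_j=\inf_{(x,t)\in\Pi}\frac{b_{jj}}{|a_j|},\qquad\beta_j=\sup_{(x,t)\in\Pi}\sum_{k\ne j}\Bigl|\frac{b_{jk}}{a_j}\Bigr|,$$ $\|R_j\|=\sup\{\|(Ru)_j\|_{BC(\mathbb R)}:u\in BC(\mathbb R;\mathbb R^n),\|u\|_{BC}=1\}$, $\|R\|=\max_{j\le n}\|R_j\|$. (B1) For each $j\le n$: $\|R_j\|+\frac{\beta_j}{\gamma_j}(1-e^{-\gamma_j})<1$ if $\inf_{x,t}b_{jj}>0$; $e^{-\gamma_j}\|R_j\|+\frac{\beta_j}{\gamma_j}(1-e^{-\gamma_j})<1$ if $\inf_{x,t}b_{jj}<0$; $\|R_j\|+\beta_j<1$ if $\inf_{x,t}b_{jj}=0$. (B2) For each $j\le n$: $\inf_{x,t}b_{jj}>0$, $e^{-\gamma_j}\|R_j\|<1$, and $$\Bigl(1+\|R\|\bigl[1-\max_{i\le n}\{e^{-\gamma_i}\|R_i\|\}\bigr]^{-1}\Bigr)\frac{\beta_j}{\gamma_j}(1-e^{-\gamma_j})<1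 .$$ *)

theory Defs
  imports "HOL-Analysis.Analysis"
begin

type_synonym 'n vec_field = "real \<times> real \<Rightarrow> (real, 'n) vec"
type_synonym 'n mat_field = "real \<times> real \<Rightarrow> ((real, 'n) vec, 'n) vec"
type_synonym 'n BC_op = "(real \<Rightarrow>\<^sub>C (real, 'n) vec) \<Rightarrow>\<^sub>L (real \<Rightarrow>\<^sub>C (real, 'n) vec)"

(* The index set {1..n} is a finite linearly ordered type 'n with n = CARD('n); idx j is the
   position of j, counted from 1, so that "j \<le> m" in the mathematics reads "idx j \<le> m". *)

definition idx :: "'n::{finite,linorder} \<Rightarrow> nat" where
  "idx j = card {i. i \<le> j}"

definition Strip :: "(real \<times> real) set" where
  "Strip = {0..1} \<times> UNIV"

(* Functions on the strip are total functions on the plane of which only the values on Strip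
   matter. For S = UNIV this is the library's set bcontfun. *)

definition BC :: "'a::topological_space set \<Rightarrow> ('a \<Rightarrow> 'b::metric_space) set" where
  "BC S = {f. continuous_on S f \<and> bounded (f ` S)}"

(* Maximum norm on R^n. The library norm on the type of bounded continuous functions takes the
   Euclidean norm of the values instead. The two are equivalent, so bounded linear operators
   are the same for both, but operator norms differ; see R_norm_comp below. *)

definition BC_norm :: "'a set \<Rightarrow> ('a \<Rightarrow> real ^ 'n) \<Rightarrow> real" where
  "BC_norm S u = Sup {\<bar>u p $ j\<bar> | p j. p \<in> S}"

(* The x-derivative is one-sided on the two boundary lines of the strip. *)

definition pd_x :: "(real \<times> real \<Rightarrow> 'b::real_normed_vector) \<Rightarrow> real \<times> real \<Rightarrow> 'b" where
  "pd_x f p = vector_derivative (\<lambda>s. f (s, snd p)) (at (fst p) within {0..1})"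

definition pd_t :: "(real \<times> real \<Rightarrow> 'b::real_normed_vector) \<Rightarrow> real \<times> real \<Rightarrow> 'b" where
  "pd_t f p = vector_derivative (\<lambda>s. f (fst p, s)) (at (snd p))"

definition BC1 :: "(real \<times> real \<Rightarrow> 'b::real_normed_vector) set" where
  "BC1 = {f. f \<in> BC Strip \<and>
     (\<forall>(x, t) \<in> Strip. (\<lambda>s. f (s, t)) differentiable (at x within {0..1}) \<and>
                     (\<lambda>s. f (x, s)) differentiable (at t)) \<and>
     pd_x f \<in> BC Strip \<and> pd_t f \<in> BC Strip}"

definition assumptions_L ::
  "nat \<Rightarrow> 'n mat_field \<Rightarrow> 'n mat_field \<Rightarrow>
   'n mat_field \<Rightarrow> ('n::{finite,linorder}) vec_field \<Rightarrow> bool" where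
  "assumptions_L m astar bstar q a \<longleftrightarrow>
     (\<forall>j k. (\<lambda>p. astar p $ j $ k) \<in> BC1) \<and>
     (\<forall>j k. (\<lambda>p. bstar p $ j $ k) \<in> BC Strip) \<and>
     m \<le> CARD('n) \<and>
     (\<forall>p \<in> Strip.
        (\<forall>j. \<exists>w. w \<noteq> 0 \<and> astar p *v w = a p $ j *\<^sub>R w) \<and>
        (\<forall>j k. j < k \<longrightarrow> a p $ j > a p $ k) \<and>
        (\<forall>j. idx j \<le> m \<longrightarrow> a p $ j > 0) \<and>
        (\<forall>j. idx j > m \<longrightarrow> a p $ j < 0)) \<and>
     (\<forall>j k. (\<lambda>p. q p $ j $ k) \<in> BC1) \<and>
     (\<forall>p \<in> Strip. invertible (q p) \<and>
        matrix_inv (q p) ** astar p ** q p = (\<chi> j k. if j = k then a p $ j else 0)) \<and>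
     (\<exists>l\<^sub>0 > 0.
        (\<forall>j. idx j \<le> m \<longrightarrow> (INF p\<in>Strip. a p $ j) > l\<^sub>0) \<and>
        (\<forall>j. idx j > m \<longrightarrow> (SUP p\<in>Strip. a p $ j) < - l\<^sub>0) \<and>
        (\<forall>j k. j \<noteq> k \<longrightarrow> (INF p\<in>Strip. \<bar>a p $ j - a p $ k\<bar>) > l\<^sub>0) \<and>
        (INF p\<in>Strip. \<bar>det (q p)\<bar>) > l\<^sub>0)"

definition diag_b ::
  "('n::finite) mat_field \<Rightarrow> 'n mat_field \<Rightarrow> 'n mat_field \<Rightarrow> 'n mat_field" where
  "diag_b astar bstar q p =
     matrix_inv (q p) ** (bstar p ** q p + pd_t q p + astar p ** pd_x q p)"

definition is_characteristic ::
  "('n::finite) vec_field \<Rightarrow> 'n \<Rightarrow> real \<Rightarrow> real \<Rightarrow> (real \<Rightarrow> real) \<Rightarrow> bool" where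
  "is_characteristic a j x t w \<longleftrightarrow>
     (\<forall>\<xi> \<in> {0..1}. (w has_real_derivative 1 / a (\<xi>, w \<xi>) $ j) (at \<xi> within {0..1})) \<and> w x = t"

(* Under assumptions_L the characteristic exists and is unique on {0..1}; its values outside
   {0..1} are unspecified and never used. *)

definition omega :: "('n::finite) vec_field \<Rightarrow> 'n \<Rightarrow> real \<Rightarrow> real \<Rightarrow> real \<Rightarrow> real" where
  "omega a j \<xi> x t = (SOME w. is_characteristic a j x t w) \<xi>"

definition x_end :: "nat \<Rightarrow> 'n::{finite,linorder} \<Rightarrow> real" where
  "x_end m j = (if idx j \<le> m then 0 else 1)"

definition c_coef ::
  "('n::finite) vec_field \<Rightarrow> 'n mat_field \<Rightarrow>
   'n \<Rightarrow> real \<Rightarrow> real \<Rightarrow> real \<Rightarrow> real" where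
  "c_coef a b j \<xi> x t =
     exp (LBINT \<eta>=x..\<xi>. b (\<eta>, omega a j \<eta> x t) $ j $ j / a (\<eta>, omega a j \<eta> x t) $ j)"

definition d_coef ::
  "('n::finite) vec_field \<Rightarrow> 'n mat_field \<Rightarrow>
   'n \<Rightarrow> real \<Rightarrow> real \<Rightarrow> real \<Rightarrow> real" where
  "d_coef a b j \<xi> x t = c_coef a b j \<xi> x t / a (\<xi>, omega a j \<xi> x t) $ j"

definition z_trace ::
  "nat \<Rightarrow> 'n vec_field \<Rightarrow> real \<Rightarrow> (real, 'n::{finite,linorder}) vec" where
  "z_trace m u t = (\<chi> j. if idx j \<le> m then u (1, t) $ j else u (0, t) $ j)"

(* Bcontfun only converts z_trace m u to the type on which R acts: under assumptions_L and for
   v in BC Strip, u and hence its trace are bounded and continuous. *)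

definition bc_solution ::
  "nat \<Rightarrow> 'n BC_op \<Rightarrow> 'n mat_field \<Rightarrow> 'n mat_field \<Rightarrow> 'n mat_field \<Rightarrow>
   'n vec_field \<Rightarrow> 'n vec_field \<Rightarrow> (real \<Rightarrow>\<^sub>C (real, 'n) vec) \<Rightarrow>
   ('n::{finite,linorder}) vec_field \<Rightarrow> bool" where
  "bc_solution m R astar bstar q a g h v \<longleftrightarrow> v \<in> BC Strip \<and>
     (let b = diag_b astar bstar q;
          u = (\<lambda>p. matrix_inv (q p) *v v p);
          Rz = apply_bcontfun (blinfun_apply R (Bcontfun (z_trace m u)))
      in \<forall>j. \<forall>(x, t) \<in> Strip.
           let \<omega> = (\<lambda>\<xi>. omega a j \<xi> x t); xj = x_end m j
           in u (x, t) $ j =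
                c_coef a b j xj x t * (Rz (\<omega> xj) $ j + apply_bcontfun h (\<omega> xj) $ j)
                - (LBINT \<xi>=xj..x. d_coef a b j \<xi> x t *
                    ((\<Sum>k \<in> UNIV - {j}. b (\<xi>, \<omega> \<xi>) $ j $ k * u (\<xi>, \<omega> \<xi>) $ k)
                     - (matrix_inv (q (\<xi>, \<omega> \<xi>)) *v g (\<xi>, \<omega> \<xi>)) $ j)))"

definition gam ::
  "('n::finite) vec_field \<Rightarrow> 'n mat_field \<Rightarrow> 'n \<Rightarrow> real" where
  "gam a b j = (INF p\<in>Strip. b p $ j $ j / \<bar>a p $ j\<bar>)"

definition bet ::
  "('n::finite) vec_field \<Rightarrow> 'n mat_field \<Rightarrow> 'n \<Rightarrow> real" where
  "bet a b j = (SUP p\<in>Strip. \<Sum>k \<in> UNIV - {j}. \<bar>b p $ j $ k / a p $ j\<bar>)"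

definition R_norm_comp ::
  "('n::finite) BC_op \<Rightarrow> 'n \<Rightarrow> real" where
  "R_norm_comp R j =
     (SUP u \<in> {u. BC_norm UNIV (apply_bcontfun u) = 1}.
        SUP t. \<bar>apply_bcontfun (blinfun_apply R u) t $ j\<bar>)"

definition R_norm :: "('n::finite) BC_op \<Rightarrow> real" where
  "R_norm R = Max (range (R_norm_comp R))"

definition cond_B1 ::
  "('n::finite) BC_op \<Rightarrow> 'n vec_field \<Rightarrow> 'n mat_field \<Rightarrow> bool" where
  "cond_B1 R a b \<longleftrightarrow> (\<forall>j.
     ((INF p\<in>Strip. b p $ j $ j) > 0 \<longrightarrow>
        R_norm_comp R j + bet a b j / gam a b j * (1 - exp (- gam a b j)) < 1) \<and>
     ((INF p\<in>Strip. b p $ j $ j) < 0 \<longrightarrow>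
        exp (- gam a b j) * R_norm_comp R j
          + bet a b j / gam a b j * (1 - exp (- gam a b j)) < 1) \<and>
     ((INF p\<in>Strip. b p $ j $ j) = 0 \<longrightarrow> R_norm_comp R j + bet a b j < 1))"

definition cond_B2 ::
  "('n::finite) BC_op \<Rightarrow> 'n vec_field \<Rightarrow> 'n mat_field \<Rightarrow> bool" where
  "cond_B2 R a b \<longleftrightarrow> (\<forall>j.
     (INF p\<in>Strip. b p $ j $ j) > 0 \<and>
     exp (- gam a b j) * R_norm_comp R j < 1 \<and>
     (1 + R_norm R * inverse (1 - Max (range (\<lambda>i. exp (- gam a b i) * R_norm_comp R i))))
        * (bet a b j / gam a b j) * (1 - exp (- gam a b j)) < 1)"

end

theory Submission
  imports Defs
begin

text \<open>Along characteristics the problem for \<open>u = q\<^sup>-\<^sup>1v\<close> is a fixed point equation \<open>u = \<Phi> u\<close> with an affine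
  \<open>\<Phi>\<close>. Let \<open>z\<close> be the outgoing boundary trace of \<open>u\<close>. At distance \<open>s\<close> from the incoming boundary the linear
  part of \<open>\<Phi>\<close> is bounded in component \<open>j\<close> by
  \<open>exp (- \<gamma>\<^sub>j s) \<parallel>R\<^sub>j\<parallel> \<parallel>z\<parallel> + \<beta>\<^sub>j (1 - exp (- \<gamma>\<^sub>j s)) / \<gamma>\<^sub>j \<parallel>u\<parallel>\<close>, and the trace of \<open>\<Phi> u\<close> only involves \<open>s = 1\<close>.
  Both (B1) and (B2) provide weights \<open>\<mu>, \<kappa> > 0\<close> for which this makes \<open>\<Phi>\<close> a contraction in the norm
  \<open>max (\<parallel>u\<parallel> / \<mu>) (\<parallel>z\<parallel> / \<kappa>)\<close>; under (B1) one can take \<open>\<mu> = \<kappa> = 1\<close>. Existence, uniqueness and the a priori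
  estimate follow.\<close>

section \<open>Integrals over oriented segments and characteristics\<close>

text \<open>What shapes the proof is (B2): it allows \<open>R\<close> to have norm above 1, and then
  the operator need not contract in the supremum norm. But \<open>R\<close> sees u only through z,
  and the outgoing value of component j lies across the whole strip from its incoming boundary, so
  the term with \<open>R\<close> returns to z with the factor exp(-gamma_j). Measuring u and z
  separately reduces the question to a nonnegative 2 by 2 matrix. The weighted norm is only
  equivalent to the norm of the function type, so a power of the map, not the map itself, is shown
  to contract there. The contraction estimate carries the data terms along. Applied to a solution it
  is therefore already the a priori estimate, and uniqueness is its case of zero data. The
  characteristics have to be constructed as well. The eigenvalues come without a smoothness
  assumption of their own; what the differential equation needs, Lipschitz continuity in t, is read
  off the diagonal of \<open>q\<^sup>-\<^sup>1a\<^sup>*q\<close>.\<close>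

lemma interval_integral_antiderivative:
  fixes g :: "real \<Rightarrow> real"
  assumes g: "continuous_on {l..u} g"
  obtains H where "\<And>z. z \<in> {l..u} \<Longrightarrow> (H has_vector_derivative g z) (at z within {l..u})"
    and "\<And>x y. x \<in> {l..u} \<Longrightarrow> y \<in> {l..u} \<Longrightarrow> (LBINT \<eta>=x..y. g \<eta>) = H y - H x"
proof -
  obtain H where H: "\<And>z. z \<in> {l..u} \<Longrightarrow> (H has_vector_derivative g z) (at z within {l..u})"
    using antiderivative_continuous[OF g] by metis
  have "(LBINT \<eta>=x..y. g \<eta>) = H y - H x" if "x \<in> {l..u}" "y \<in> {l..u}" for x y
  proof -
    have sub: "{min x y..max x y} \<subseteq> {l..u}" using that by auto
    show ?thesis
    proof (rule interval_integral_FTC_finite)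
      show "continuous_on {min x y..max x y} g" by (rule continuous_on_subset[OF g sub])
      show "(H has_vector_derivative g z) (at z within {min x y..max x y})"
        if "min x y \<le> z" "z \<le> max x y" for z
        by (rule has_vector_derivative_within_subset[OF H sub]) (use sub that in auto)
    qed
  qed
  with H show ?thesis by (rule that)
qed

text \<open>Written as a multiple of an integral over a fixed interval, the oriented integral needs no case
  distinction between \<open>x \<le> y\<close> and \<open>y \<le> x\<close>, and it depends continuously on parameters.\<close>

lemma segment_integral:
  fixes g :: "real \<Rightarrow> real"
  assumes g: "continuous_on {l..u} g" and x: "x \<in> {l..u}" and y: "y \<in> {l..u}"
  shows "(LBINT \<eta>=x..y. g \<eta>) = (y - x) * integral {0..1} (\<lambda>s. g (x + s * (y - x)))"
    and "(\<lambda>s. g (x + s * (y - x))) integrable_on {0..1}"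
proof -
  obtain H where H: "\<And>z. z \<in> {l..u} \<Longrightarrow> (H has_vector_derivative g z) (at z within {l..u})"
    and eq: "\<And>x y. x \<in> {l..u} \<Longrightarrow> y \<in> {l..u} \<Longrightarrow> (LBINT \<eta>=x..y. g \<eta>) = H y - H x"
    using interval_integral_antiderivative[OF g] by blast
  have "(LBINT \<eta>=x..y. g \<eta>) = H y - H x" using x y by (rule eq)
  moreover have line: "x + s * (y - x) \<in> {l..u}" if "s \<in> {0..1}" for s
    using x y that convexD_alt[of "{l..u}" x y s] by (simp add: algebra_simps)
  have "((\<lambda>s. (y - x) * g (x + s * (y - x))) has_integral H (x + 1 * (y - x)) - H (x + 0 * (y - x))) {0..1}"
  proof (rule fundamental_theorem_of_calculus)
    fix s :: real assume s: "s \<in> {0..1}"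
    have 1: "((\<lambda>s. x + s * (y - x)) has_vector_derivative (y - x)) (at s within {0..1})"
      unfolding has_real_derivative_iff_has_vector_derivative[symmetric]
      by (auto intro!: derivative_eq_intros)
    have 2: "(H has_vector_derivative g (x + s * (y - x)))
        (at (x + s * (y - x)) within (\<lambda>s. x + s * (y - x)) ` {0..1})"
      by (rule has_vector_derivative_within_subset[OF H]) (use line s in auto)
    show "((\<lambda>s. H (x + s * (y - x))) has_vector_derivative (y - x) * g (x + s * (y - x)))
        (at s within {0..1})"
      using DERIV_image_chain[OF 2[folded has_real_derivative_iff_has_vector_derivative]
          1[folded has_real_derivative_iff_has_vector_derivative]]
      unfolding has_real_derivative_iff_has_vector_derivative[symmetric] o_def
      by (simp only: mult.commute)
  qed auto
  then have "H y - H x = (y - x) * integral {0..1} (\<lambda>s. g (x + s * (y - x)))"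
    by (simp add: has_integral_iff flip: integral_mult_right)
  ultimately show "(LBINT \<eta>=x..y. g \<eta>) = (y - x) * integral {0..1} (\<lambda>s. g (x + s * (y - x)))" by simp
  show "(\<lambda>s. g (x + s * (y - x))) integrable_on {0..1}"
    by (intro integrable_continuous_real continuous_on_compose2[OF g] continuous_intros) (use line in auto)
qed

lemma segment_integral_has_derivative:
  fixes g :: "real \<Rightarrow> real"
  assumes g: "continuous_on {l..u} g" and x: "x \<in> {l..u}" and y: "y \<in> {l..u}"
  shows "((\<lambda>y. LBINT \<eta>=x..y. g \<eta>) has_real_derivative g y) (at y within {l..u})"
proof -
  obtain H where H: "\<And>z. z \<in> {l..u} \<Longrightarrow> (H has_vector_derivative g z) (at z within {l..u})"
    and eq: "\<And>x y. x \<in> {l..u} \<Longrightarrow> y \<in> {l..u} \<Longrightarrow> (LBINT \<eta>=x..y. g \<eta>) = H y - H x"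
    using interval_integral_antiderivative[OF g] by blast
  have "((\<lambda>z. H z - H x) has_real_derivative g y) (at y within {l..u})"
    using H[OF y] unfolding has_real_derivative_iff_has_vector_derivative[symmetric]
    by (auto intro!: derivative_eq_intros)
  then show ?thesis
    by (rule has_field_derivative_transform_within[where d=1]) (use x y eq in auto)
qed

section \<open>Exponential decay along a segment\<close>

text \<open>This is the integral of exp(-\<gamma> \<tau>) over \<tau> from 0 to s, with the limit
  value at \<gamma> = 0. At s = 1 it is the factor of beta_j in (B1) and (B2), including the
  degenerate case of (B1).\<close>

definition decay_int :: "real \<Rightarrow> real \<Rightarrow> real" where
  "decay_int \<gamma> s = (if \<gamma> = 0 then s else (1 - exp (- \<gamma> * s)) / \<gamma>)"

lemma decay_int_has_integral:
  "((\<lambda>\<sigma>. S * exp (- \<gamma> * (\<sigma> * S))) has_integral decay_int \<gamma> S) {0..1}"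
proof (cases "\<gamma> = 0")
  case True
  then show ?thesis using has_integral_const_real[of S 0 1] by (simp add: decay_int_def)
next
  case False
  have "((\<lambda>\<sigma>. S * exp (- \<gamma> * (\<sigma> * S))) has_integral
      - exp (- \<gamma> * (1 * S)) / \<gamma> - (- exp (- \<gamma> * (0 * S)) / \<gamma>)) {0..1}"
    by (rule fundamental_theorem_of_calculus)
       (use False in \<open>auto intro!: derivative_eq_intros simp flip: has_real_derivative_iff_has_vector_derivative\<close>)
  then show ?thesis using False by (simp add: decay_int_def field_simps)
qed

lemma decay_int_mono: "decay_int \<gamma> s \<le> decay_int \<gamma> t" if "s \<le> t"
proof -
  consider "\<gamma> = 0" | "\<gamma> > 0" | "\<gamma> < 0" by linarith
  then show ?thesis using that
    by cases (auto simp: decay_int_def divide_right_mono divide_right_mono_neg)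
qed

lemma decay_int_nonneg: "0 \<le> decay_int \<gamma> s" if "0 \<le> s"
  using decay_int_mono[OF that, of \<gamma>] by (simp add: decay_int_def split: if_splits)

text \<open>Decay is measured from the starting point x, and the bound is asked only on the segment,
  because the exponential coefficients are controlled only towards the incoming boundary. The rate
  may be zero (a plain bound) or negative (exponential weights for the differential
  equation).\<close>

lemma segment_integral_bound:
  fixes g :: "real \<Rightarrow> real"
  assumes g: "continuous_on {l..u} g" and x: "x \<in> {l..u}" and y: "y \<in> {l..u}"
    and bd: "\<And>\<eta>. \<eta> \<in> {l..u} \<Longrightarrow> \<eta> \<in> closed_segment x y \<Longrightarrow> \<bar>g \<eta>\<bar> \<le> K * exp (- \<gamma> * \<bar>\<eta> - x\<bar>)"
  shows "\<bar>LBINT \<eta>=x..y. g \<eta>\<bar> \<le> K * decay_int \<gamma> \<bar>y - x\<bar>"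
proof -
  let ?S = "\<bar>y - x\<bar>"
  have line: "x + s * (y - x) \<in> {l..u}" if "s \<in> {0..1}" for s
    using x y that convexD_alt[of "{l..u}" x y s] by (simp add: algebra_simps)
  have seg: "x + s * (y - x) \<in> closed_segment x y" if "s \<in> {0..1}" for s
    using that by (auto simp: closed_segment_def algebra_simps intro!: exI[of _ s])
  note I = segment_integral[OF g x y]
  have E: "((\<lambda>s. K * (?S * exp (- \<gamma> * (s * ?S)))) has_integral K * decay_int \<gamma> ?S) {0..1}"
    by (rule has_integral_mult_right[OF decay_int_has_integral])
  have "norm (integral {0..1} (\<lambda>s. (y - x) * g (x + s * (y - x)))) \<le>
      integral {0..1} (\<lambda>s. K * (?S * exp (- \<gamma> * (s * ?S))))"
  proof (rule integral_norm_bound_integral)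
    show "(\<lambda>s. (y - x) * g (x + s * (y - x))) integrable_on {0..1}"
      using I(2) integrable_on_mult_right by blast
    show "(\<lambda>s. K * (?S * exp (- \<gamma> * (s * ?S)))) integrable_on {0..1}" using E by blast
    fix s :: real assume s: "s \<in> {0..1}"
    have "\<bar>g (x + s * (y - x))\<bar> \<le> K * exp (- \<gamma> * \<bar>x + s * (y - x) - x\<bar>)"
      by (rule bd[OF line[OF s] seg[OF s]])
    also have "\<bar>x + s * (y - x) - x\<bar> = s * ?S" using s by (simp add: abs_mult)
    finally have "?S * \<bar>g (x + s * (y - x))\<bar> \<le> ?S * (K * exp (- \<gamma> * (s * ?S)))"
      by (intro mult_left_mono) auto
    then show "norm ((y - x) * g (x + s * (y - x))) \<le> K * (?S * exp (- \<gamma> * (s * ?S)))"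
      by (simp add: abs_mult mult_ac)
  qed
  also have "\<dots> = K * decay_int \<gamma> ?S" using E by (rule integral_unique)
  finally show ?thesis using I(1) by simp
qed

lemma segment_integral_diff:
  fixes f g :: "real \<Rightarrow> real"
  assumes "continuous_on {l..u} f" "continuous_on {l..u} g" "x \<in> {l..u}" "y \<in> {l..u}"
  shows "(LBINT \<eta>=x..y. f \<eta> - g \<eta>) = (LBINT \<eta>=x..y. f \<eta>) - (LBINT \<eta>=x..y. g \<eta>)"
proof -
  have c: "continuous_on {l..u} (\<lambda>\<eta>. f \<eta> - g \<eta>)" using assms by (intro continuous_intros)
  show ?thesis
    unfolding segment_integral(1)[OF c assms(3,4)] segment_integral(1)[OF assms(1,3,4)]
      segment_integral(1)[OF assms(2,3,4)]
      integral_diff[OF segment_integral(2)[OF assms(1,3,4)] segment_integral(2)[OF assms(2,3,4)]]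
    by (rule right_diff_distrib)
qed

text \<open>The weight \<open>exp (2 * L * \<bar>\<xi> - x\<bar>)\<close> makes the Picard operator a contraction with factor 1/2 on the
  whole interval at once.\<close>

lemma ode_solution_exists:
  fixes f :: "real \<times> real \<Rightarrow> real"
  assumes f: "continuous_on ({l..u} \<times> UNIV) f" and x: "x \<in> {l..u}"
    and B: "\<And>p. p \<in> {l..u} \<times> UNIV \<Longrightarrow> \<bar>f p\<bar> \<le> B"
    and L: "\<And>\<xi> s t. \<xi> \<in> {l..u} \<Longrightarrow> \<bar>f (\<xi>, s) - f (\<xi>, t)\<bar> \<le> L * \<bar>s - t\<bar>" and "L > 0"
  shows "\<exists>w. (\<forall>\<xi>\<in>{l..u}. (w has_real_derivative f (\<xi>, w \<xi>)) (at \<xi> within {l..u})) \<and> w x = t"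
proof -
  let ?\<kappa> = "2 * L"
  \<comment> \<open>Clamping to \<open>{l..u}\<close> turns functions on the interval into bounded
    continuous functions on the line, which form a complete type.\<close>
  define cl where "cl \<xi> = max l (min u \<xi>)" for \<xi> :: real
  have cl: "cl \<xi> \<in> {l..u}" for \<xi> using x by (auto simp: cl_def)
  have cl_id: "\<xi> \<in> {l..u} \<Longrightarrow> cl \<xi> = \<xi>" for \<xi> by (auto simp: cl_def)
  \<comment> \<open>The unknown \<open>w\<close> is the deviation from the initial value divided by
    the weight; the ordinary supremum distance of \<open>w\<close> is then the weighted distance of
    the candidate solutions.\<close>
  define W where "W w \<xi> = t + exp (?\<kappa> * \<bar>\<xi> - x\<bar>) * apply_bcontfun w \<xi>" for w :: "real \<Rightarrow>\<^sub>C real" and \<xi>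
  have W_cont: "continuous_on A (W w)" for A w
    unfolding W_def by (intro continuous_intros) auto
  define I where "I w \<xi> = (LBINT \<eta>=x..\<xi>. f (\<eta>, W w \<eta>))" for w and \<xi> :: real
  have fW: "continuous_on {l..u} (\<lambda>\<eta>. f (\<eta>, W w \<eta>))" for w
    by (rule continuous_on_compose2[OF f]) (auto intro!: continuous_intros W_cont)
  have I_der: "(I w has_real_derivative f (\<xi>, W w \<xi>)) (at \<xi> within {l..u})" if "\<xi> \<in> {l..u}" for w \<xi>
    unfolding I_def by (rule segment_integral_has_derivative[OF fW x that])
  have I_cont: "continuous_on {l..u} (I w)" for w
    by (rule DERIV_continuous_on, rule I_der)
  define T where "T w = Bcontfun (\<lambda>\<xi>. exp (- ?\<kappa> * \<bar>cl \<xi> - x\<bar>) * I w (cl \<xi>))" for w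
  have cl_cont: "continuous_on UNIV cl" unfolding cl_def by (intro continuous_intros)
  have T_bc: "(\<lambda>\<xi>. exp (- ?\<kappa> * \<bar>cl \<xi> - x\<bar>) * I w (cl \<xi>)) \<in> bcontfun" for w
  proof (rule bcontfun_normI)
    show "continuous_on UNIV (\<lambda>\<xi>. exp (- ?\<kappa> * \<bar>cl \<xi> - x\<bar>) * I w (cl \<xi>))"
      by (intro continuous_intros continuous_on_compose2[OF I_cont] cl_cont) (use cl in auto)
    fix \<xi>
    have "\<bar>I w (cl \<xi>)\<bar> \<le> B * decay_int 0 \<bar>cl \<xi> - x\<bar>"
      unfolding I_def by (rule segment_integral_bound[OF fW x cl]) (use B in auto)
    also have "\<dots> \<le> \<bar>B\<bar> * (u - l)"
      using cl[of \<xi>] x by (intro mult_mono) (auto simp: decay_int_def)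
    finally have "\<bar>I w (cl \<xi>)\<bar> \<le> \<bar>B\<bar> * (u - l)" .
    moreover have "exp (- ?\<kappa> * \<bar>cl \<xi> - x\<bar>) \<le> 1" using \<open>L > 0\<close> by simp
    ultimately have "exp (- ?\<kappa> * \<bar>cl \<xi> - x\<bar>) * \<bar>I w (cl \<xi>)\<bar> \<le> 1 * (\<bar>B\<bar> * (u - l))"
      by (intro mult_mono) auto
    then show "norm (exp (- ?\<kappa> * \<bar>cl \<xi> - x\<bar>) * I w (cl \<xi>)) \<le> \<bar>B\<bar> * (u - l)"
      by (simp add: abs_mult)
  qed
  have T_apply: "apply_bcontfun (T w) \<xi> = exp (- ?\<kappa> * \<bar>cl \<xi> - x\<bar>) * I w (cl \<xi>)" for w \<xi>
    unfolding T_def by (subst Bcontfun_inverse[OF T_bc]) simp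
  have "\<exists>!w. T w = w"
  proof (rule banach_fix_type)
    show "\<forall>v w. dist (T v) (T w) \<le> 1/2 * dist v w"
    proof (intro allI dist_bound)
      fix v w :: "real \<Rightarrow>\<^sub>C real" and \<xi>
      let ?d = "dist v w" and ?c = "cl \<xi>"
      have "\<bar>LBINT \<eta>=x..?c. f (\<eta>, W v \<eta>) - f (\<eta>, W w \<eta>)\<bar> \<le> (L * ?d) * decay_int (- ?\<kappa>) \<bar>?c - x\<bar>"
      proof (rule segment_integral_bound[OF _ x cl])
        show "continuous_on {l..u} (\<lambda>\<eta>. f (\<eta>, W v \<eta>) - f (\<eta>, W w \<eta>))"
          by (intro continuous_intros fW)
        fix \<eta> assume "\<eta> \<in> {l..u}"
        then have "\<bar>f (\<eta>, W v \<eta>) - f (\<eta>, W w \<eta>)\<bar> \<le> L * \<bar>W v \<eta> - W w \<eta>\<bar>" by (rule L)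
        also have "\<bar>W v \<eta> - W w \<eta>\<bar> = exp (?\<kappa> * \<bar>\<eta> - x\<bar>) * dist (apply_bcontfun v \<eta>) (apply_bcontfun w \<eta>)"
          by (simp add: W_def dist_real_def abs_mult flip: right_diff_distrib)
        also have "\<dots> \<le> exp (?\<kappa> * \<bar>\<eta> - x\<bar>) * ?d"
          by (intro mult_left_mono dist_bounded) auto
        finally show "\<bar>f (\<eta>, W v \<eta>) - f (\<eta>, W w \<eta>)\<bar> \<le> L * ?d * exp (- (- ?\<kappa>) * \<bar>\<eta> - x\<bar>)"
          using \<open>L > 0\<close> by (simp add: mult_ac)
      qed
      \<comment> \<open>Integrating the weight gives (exp(2 L s) - 1) / (2 L); the Lipschitz
        constant L cancels and 1/2 remains.\<close>
      also have "\<dots> = ?d / 2 * (exp (?\<kappa> * \<bar>?c - x\<bar>) - 1)"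
        using \<open>L > 0\<close> by (simp add: decay_int_def field_simps)
      also have "\<dots> \<le> ?d / 2 * exp (?\<kappa> * \<bar>?c - x\<bar>)" by (intro mult_left_mono) auto
      finally have "\<bar>I v ?c - I w ?c\<bar> \<le> ?d / 2 * exp (?\<kappa> * \<bar>?c - x\<bar>)"
        unfolding I_def by (subst (asm) segment_integral_diff[OF fW fW x cl])
      then have "exp (- ?\<kappa> * \<bar>?c - x\<bar>) * \<bar>I v ?c - I w ?c\<bar> \<le>
          exp (- ?\<kappa> * \<bar>?c - x\<bar>) * (?d / 2 * exp (?\<kappa> * \<bar>?c - x\<bar>))"
        by (intro mult_left_mono) auto
      also have "\<dots> = 1/2 * ?d" by (simp add: exp_minus field_simps)
      finally show "dist (apply_bcontfun (T v) \<xi>) (apply_bcontfun (T w) \<xi>) \<le> 1/2 * ?d"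
        by (simp add: T_apply dist_real_def abs_mult flip: right_diff_distrib)
    qed
  qed auto
  then obtain w where w: "T w = w" by blast
  have WI: "W w \<xi> = t + I w \<xi>" if "\<xi> \<in> {l..u}" for \<xi>
    using T_apply[of w \<xi>] that by (simp add: w W_def cl_id exp_minus)
  have "(W w has_real_derivative f (\<xi>, W w \<xi>)) (at \<xi> within {l..u})" if \<xi>: "\<xi> \<in> {l..u}" for \<xi>
  proof (rule has_field_derivative_transform_within[where d=1])
    show "((\<lambda>\<xi>. t + I w \<xi>) has_real_derivative f (\<xi>, W w \<xi>)) (at \<xi> within {l..u})"
      using I_der[OF \<xi>] by (auto intro!: derivative_eq_intros)
  qed (use WI \<xi> in auto)
  moreover have "W w x = t" using WI[OF x] by (simp add: I_def)
  ultimately show ?thesis by blast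
qed

text \<open>A Gronwall argument for the square of the difference, which is differentiable where the
  absolute value need not be: times exp(-2 L \<xi>) it decreases, times exp(2 L \<xi>) it increases.
  The former serves y to the right of x, the latter y to the left.\<close>

lemma ode_solution_dependence:
  fixes f :: "real \<times> real \<Rightarrow> real"
  assumes v: "\<And>\<xi>. \<xi> \<in> {l..u} \<Longrightarrow> (v has_real_derivative f (\<xi>, v \<xi>)) (at \<xi> within {l..u})"
    and w: "\<And>\<xi>. \<xi> \<in> {l..u} \<Longrightarrow> (w has_real_derivative f (\<xi>, w \<xi>)) (at \<xi> within {l..u})"
    and L: "\<And>\<xi> s t. \<xi> \<in> {l..u} \<Longrightarrow> \<bar>f (\<xi>, s) - f (\<xi>, t)\<bar> \<le> L * \<bar>s - t\<bar>"
    and x: "x \<in> {l..u}" and y: "y \<in> {l..u}"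
  shows "\<bar>v y - w y\<bar> \<le> exp (L * \<bar>y - x\<bar>) * \<bar>v x - w x\<bar>"
proof -
  define \<delta> where "\<delta> \<xi> = v \<xi> - w \<xi>" for \<xi>
  define \<delta>' where "\<delta>' \<xi> = f (\<xi>, v \<xi>) - f (\<xi>, w \<xi>)" for \<xi>
  have d: "(\<delta> has_real_derivative \<delta>' \<xi>) (at \<xi> within {l..u})" if "\<xi> \<in> {l..u}" for \<xi>
    unfolding \<delta>_def \<delta>'_def using v[OF that] w[OF that] by (auto intro!: derivative_eq_intros)
  have dd: "\<bar>\<delta> \<xi> * \<delta>' \<xi>\<bar> \<le> L * (\<delta> \<xi>)\<^sup>2" if "\<xi> \<in> {l..u}" for \<xi>
  proof -
    have "\<bar>\<delta> \<xi> * \<delta>' \<xi>\<bar> \<le> \<bar>\<delta> \<xi>\<bar> * (L * \<bar>\<delta> \<xi>\<bar>)"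
      unfolding abs_mult \<delta>_def \<delta>'_def by (intro mult_left_mono L that) auto
    also have "\<dots> = L * (\<bar>\<delta> \<xi>\<bar> * \<bar>\<delta> \<xi>\<bar>)" by simp
    finally show ?thesis by (simp only: abs_mult_self_eq power2_eq_square)
  qed
  have der: "((\<lambda>\<xi>. exp (c * \<xi>) * (\<delta> \<xi>)\<^sup>2) has_real_derivative
      exp (c * \<xi>) * (c * (\<delta> \<xi>)\<^sup>2 + 2 * (\<delta> \<xi> * \<delta>' \<xi>))) (at \<xi> within {a..b})"
    if "\<xi> \<in> {a..b}" "{a..b} \<subseteq> {l..u}" for c \<xi> a b
  proof -
    have \<delta>: "(\<delta> has_real_derivative \<delta>' \<xi>) (at \<xi> within {a..b})"
      by (rule DERIV_subset[OF d]) (use that in auto)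
    show ?thesis
      by (rule derivative_eq_intros refl \<delta>)+ (simp add: algebra_simps)
  qed
  have cont: "continuous_on {a..b} (\<lambda>\<xi>. exp (c * \<xi>) * (\<delta> \<xi>)\<^sup>2)" if "{a..b} \<subseteq> {l..u}" for c a b
    by (rule DERIV_continuous_on, rule der[OF _ that])
  have int: "((\<lambda>\<xi>. exp (c * \<xi>) * (\<delta> \<xi>)\<^sup>2) has_real_derivative
      exp (c * \<xi>) * (c * (\<delta> \<xi>)\<^sup>2 + 2 * (\<delta> \<xi> * \<delta>' \<xi>))) (at \<xi>)"
    if "a < \<xi>" "\<xi> < b" "{a..b} \<subseteq> {l..u}" for c \<xi> a b
    using der[of \<xi> a b c] that at_within_Icc_at[of a \<xi> b] by auto
  have exp_mult: "exp s * (exp r * z) = exp (s + r) * z" for r s z :: real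
    by (simp add: exp_add mult.assoc)
  have "(\<delta> y)\<^sup>2 \<le> exp (2 * L * \<bar>y - x\<bar>) * (\<delta> x)\<^sup>2"
  proof (cases "x \<le> y")
    case True
    then have sub: "{x..y} \<subseteq> {l..u}" using x y by auto
    have "exp ((- 2 * L) * y) * (\<delta> y)\<^sup>2 \<le> exp ((- 2 * L) * x) * (\<delta> x)\<^sup>2"
    proof (rule DERIV_nonpos_imp_decreasing_open[OF True _ cont[OF sub]])
      fix \<xi> assume \<xi>: "x < \<xi>" "\<xi> < y"
      then have "(- 2 * L) * (\<delta> \<xi>)\<^sup>2 + 2 * (\<delta> \<xi> * \<delta>' \<xi>) \<le> 0"
        using dd[of \<xi>] sub by (auto simp: abs_le_iff)
      then show "\<exists>y. ((\<lambda>\<xi>. exp ((- 2 * L) * \<xi>) * (\<delta> \<xi>)\<^sup>2) has_real_derivative y) (at \<xi>) \<and> y \<le> 0"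
        using int[OF \<xi> sub, of "- 2 * L"] by (meson exp_ge_zero mult_nonneg_nonpos)
    qed
    then have "exp (2 * L * y) * (exp ((- 2 * L) * y) * (\<delta> y)\<^sup>2) \<le>
        exp (2 * L * y) * (exp ((- 2 * L) * x) * (\<delta> x)\<^sup>2)"
      by (intro mult_left_mono) auto
    then show ?thesis using True unfolding exp_mult by (simp add: algebra_simps)
  next
    case False
    then have yx: "y \<le> x" and sub: "{y..x} \<subseteq> {l..u}" using x y by auto
    have "exp ((2 * L) * y) * (\<delta> y)\<^sup>2 \<le> exp ((2 * L) * x) * (\<delta> x)\<^sup>2"
    proof (rule DERIV_nonneg_imp_increasing_open[OF yx _ cont[OF sub]])
      fix \<xi> assume \<xi>: "y < \<xi>" "\<xi> < x"
      then have "(2 * L) * (\<delta> \<xi>)\<^sup>2 + 2 * (\<delta> \<xi> * \<delta>' \<xi>) \<ge> 0"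
        using dd[of \<xi>] sub by (auto simp: abs_le_iff)
      then show "\<exists>y. ((\<lambda>\<xi>. exp ((2 * L) * \<xi>) * (\<delta> \<xi>)\<^sup>2) has_real_derivative y) (at \<xi>) \<and> 0 \<le> y"
        using int[OF \<xi> sub, of "2 * L"] by (meson exp_ge_zero mult_nonneg_nonneg)
    qed
    then have "exp (- (2 * L * y)) * (exp ((2 * L) * y) * (\<delta> y)\<^sup>2) \<le>
        exp (- (2 * L * y)) * (exp ((2 * L) * x) * (\<delta> x)\<^sup>2)"
      by (intro mult_left_mono) auto
    then show ?thesis using False unfolding exp_mult by (simp add: algebra_simps)
  qed
  also have "\<dots> = (exp (L * \<bar>y - x\<bar>) * \<bar>\<delta> x\<bar>)\<^sup>2"
    by (simp add: power_mult_distrib exp_double mult.assoc)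
  finally have "\<bar>\<delta> y\<bar> \<le> \<bar>exp (L * \<bar>y - x\<bar>) * \<bar>\<delta> x\<bar>\<bar>" by (simp only: abs_le_square_iff)
  then show ?thesis by (simp add: \<delta>_def abs_mult)
qed

section \<open>Bounded continuous functions on the strip\<close>

lemma BC_cong: "f \<in> BC S \<Longrightarrow> (\<And>p. p \<in> S \<Longrightarrow> f p = g p) \<Longrightarrow> g \<in> BC S"
  by (auto simp: BC_def cong: continuous_on_cong image_cong_simp)

lemma BC_I:
  fixes f :: "'a::topological_space \<Rightarrow> 'b::real_normed_vector"
  shows "continuous_on S f \<Longrightarrow> (\<And>p. p \<in> S \<Longrightarrow> norm (f p) \<le> B) \<Longrightarrow> f \<in> BC S"
  by (auto simp: BC_def intro!: boundedI)

lemma BC_continuous: "f \<in> BC S \<Longrightarrow> continuous_on S f"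
  by (simp add: BC_def)

lemma BC_bound:
  fixes f :: "'a::topological_space \<Rightarrow> 'b::real_normed_vector"
  assumes "f \<in> BC S"
  obtains B where "B > 0" "\<And>p. p \<in> S \<Longrightarrow> norm (f p) \<le> B"
  using assms unfolding BC_def bounded_pos by auto

lemma BC_const: "(\<lambda>_. c) \<in> BC S" for c :: "'b::real_normed_vector"
  by (rule BC_I[where B="norm c"]) auto

lemma BC_add:
  fixes f :: "'a::topological_space \<Rightarrow> 'b::real_normed_vector"
  assumes "f \<in> BC S" "g \<in> BC S" shows "(\<lambda>p. f p + g p) \<in> BC S"
  using assms unfolding BC_def by (auto intro!: continuous_intros bounded_plus_comp)

lemma BC_diff:
  fixes f :: "'a::topological_space \<Rightarrow> 'b::real_normed_vector"
  assumes "f \<in> BC S" "g \<in> BC S" shows "(\<lambda>p. f p - g p) \<in> BC S"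
  using assms unfolding BC_def by (auto intro!: continuous_intros bounded_minus_comp)

lemma BC_mult:
  fixes f :: "'a::topological_space \<Rightarrow> real"
  assumes "f \<in> BC S" "g \<in> BC S" shows "(\<lambda>p. f p * g p) \<in> BC S"
proof -
  obtain B C where "\<And>p. p \<in> S \<Longrightarrow> norm (f p) \<le> B" "\<And>p. p \<in> S \<Longrightarrow> norm (g p) \<le> C" "B > 0"
    using assms BC_bound by metis
  then have "p \<in> S \<Longrightarrow> norm (f p * g p) \<le> B * C" for p
    by (auto simp: abs_mult intro!: mult_mono)
  then show ?thesis
    by (intro BC_I[where B="B * C"]) (use assms in \<open>auto simp: BC_def intro!: continuous_intros\<close>)
qed

lemma BC_sum:
  fixes f :: "'i \<Rightarrow> 'a::topological_space \<Rightarrow> real"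
  assumes "\<And>i. i \<in> I \<Longrightarrow> f i \<in> BC S" shows "(\<lambda>p. \<Sum>i\<in>I. f i p) \<in> BC S"
  using assms by (induction I rule: infinite_finite_induct) (auto intro: BC_const BC_add)

lemma BC_inverse:
  fixes f :: "'a::topological_space \<Rightarrow> real"
  assumes "f \<in> BC S" "c > 0" "\<And>p. p \<in> S \<Longrightarrow> c \<le> \<bar>f p\<bar>" shows "(\<lambda>p. inverse (f p)) \<in> BC S"
proof (rule BC_I[where B="inverse c"])
  show "continuous_on S (\<lambda>p. inverse (f p))"
    using assms by (intro continuous_on_inverse BC_continuous) force+
  show "norm (inverse (f p)) \<le> inverse c" if "p \<in> S" for p
    using assms(2) assms(3)[OF that] by (simp add: le_imp_inverse_le)
qed

lemma BC_divide:
  fixes f :: "'a::topological_space \<Rightarrow> real"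
  assumes "f \<in> BC S" "g \<in> BC S" "c > 0" "\<And>p. p \<in> S \<Longrightarrow> c \<le> \<bar>g p\<bar>"
  shows "(\<lambda>p. f p / g p) \<in> BC S"
  unfolding divide_inverse by (intro BC_mult assms(1) BC_inverse[OF assms(2-4)])

lemma BC_vec_iff:
  fixes f :: "'a::topological_space \<Rightarrow> 'b::real_normed_vector ^ 'n"
  shows "f \<in> BC S \<longleftrightarrow> (\<forall>j. (\<lambda>p. f p $ j) \<in> BC S)"
proof
  assume f: "f \<in> BC S"
  then obtain B where B: "\<And>p. p \<in> S \<Longrightarrow> norm (f p) \<le> B" using BC_bound by metis
  show "\<forall>j. (\<lambda>p. f p $ j) \<in> BC S"
  proof (intro allI BC_I)
    show "continuous_on S (\<lambda>p. f p $ j)" for j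
      by (intro continuous_on_component BC_continuous f)
    show "norm (f p $ j) \<le> B" if "p \<in> S" for j p
      by (rule order.trans[OF Finite_Cartesian_Product.norm_nth_le B[OF that]])
  qed
next
  assume f: "\<forall>j. (\<lambda>p. f p $ j) \<in> BC S"
  have "\<exists>B. \<forall>p\<in>S. norm (f p $ j) \<le> B" for j
    using BC_bound[OF f[rule_format, of j]] by metis
  then obtain B where B: "\<And>j p. p \<in> S \<Longrightarrow> norm (f p $ j) \<le> B j" by metis
  show "f \<in> BC S"
  proof (rule BC_I[where B="\<Sum>j\<in>UNIV. B j"])
    have "continuous_on S (\<lambda>p. \<chi> j. f p $ j)" by (intro continuous_intros BC_continuous) (use f in auto)
    then show "continuous_on S f" by simp
    show "norm (f p) \<le> (\<Sum>j\<in>UNIV. B j)" if "p \<in> S" for p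
      unfolding norm_vec_def
      by (rule order.trans[OF L2_set_le_sum]) (auto intro!: sum_mono B that)
  qed
qed

lemma BC_matrix_vector_mult:
  fixes A :: "'a::topological_space \<Rightarrow> real ^ 'm ^ 'n"
  assumes "A \<in> BC S" "v \<in> BC S" shows "(\<lambda>p. A p *v v p) \<in> BC S"
  using assms unfolding BC_vec_iff[of "\<lambda>p. A p *v v p"] matrix_vector_mult_def
  by (auto simp: BC_vec_iff intro!: BC_sum BC_mult)

lemma BC_matrix_matrix_mult:
  fixes A :: "'a::topological_space \<Rightarrow> real ^ 'm ^ 'n"
  assumes "A \<in> BC S" "B \<in> BC S" shows "(\<lambda>p. A p ** B p) \<in> BC S"
  using assms unfolding BC_vec_iff[of "\<lambda>p. A p ** B p"] matrix_matrix_mult_def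
  by (auto simp: BC_vec_iff intro!: BC_sum BC_mult)

section \<open>Lipschitz continuity in time\<close>

text \<open>The regularity that characteristics need, uniform in the space variable. It follows from
  \<open>BC1\<close> and passes to sums, products, determinants and reciprocals without computing
  derivatives, and in this way reaches the eigenvalues.\<close>

definition BC_Lip :: "(real \<times> real \<Rightarrow> real) set" where
  "BC_Lip = {f \<in> BC Strip. \<exists>L. \<forall>x\<in>{0..1}. \<forall>s t. \<bar>f (x, s) - f (x, t)\<bar> \<le> L * \<bar>s - t\<bar>}"

lemma BC_Lip_cong: "f \<in> BC_Lip \<Longrightarrow> (\<And>p. p \<in> Strip \<Longrightarrow> f p = g p) \<Longrightarrow> g \<in> BC_Lip"
  unfolding BC_Lip_def using BC_cong[of f Strip g] by (auto simp: Strip_def)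

lemma BC_LipI:
  assumes "f \<in> BC Strip" "\<And>x s t. x \<in> {0..1} \<Longrightarrow> \<bar>f (x, s) - f (x, t)\<bar> \<le> L * \<bar>s - t\<bar>"
  shows "f \<in> BC_Lip"
  using assms unfolding BC_Lip_def by blast

lemma BC_LipE:
  assumes "f \<in> BC_Lip"
  obtains L where "L > 0" "\<And>x s t. x \<in> {0..1} \<Longrightarrow> \<bar>f (x, s) - f (x, t)\<bar> \<le> L * \<bar>s - t\<bar>"
proof -
  obtain L where L: "\<And>x s t. x \<in> {0..1} \<Longrightarrow> \<bar>f (x, s) - f (x, t)\<bar> \<le> L * \<bar>s - t\<bar>"
    using assms unfolding BC_Lip_def by blast
  have "\<bar>f (x, s) - f (x, t)\<bar> \<le> (\<bar>L\<bar> + 1) * \<bar>s - t\<bar>" if "x \<in> {0..1}" for x s t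
    by (rule order.trans[OF L[OF that]]) (intro mult_right_mono, auto)
  then show ?thesis using that[of "\<bar>L\<bar> + 1"] by auto
qed

lemma BC_Lip_BC: "f \<in> BC_Lip \<Longrightarrow> f \<in> BC Strip"
  by (simp add: BC_Lip_def)

lemma BC_Lip_const: "(\<lambda>_. c) \<in> BC_Lip"
  by (auto simp: BC_Lip_def BC_const intro!: exI[of _ 0])

lemma BC_Lip_add:
  assumes "f \<in> BC_Lip" "g \<in> BC_Lip" shows "(\<lambda>p. f p + g p) \<in> BC_Lip"
proof -
  obtain L K where LK: "\<And>x s t. x \<in> {0..1} \<Longrightarrow> \<bar>f (x, s) - f (x, t)\<bar> \<le> L * \<bar>s - t\<bar>"
      "\<And>x s t. x \<in> {0..1} \<Longrightarrow> \<bar>g (x, s) - g (x, t)\<bar> \<le> K * \<bar>s - t\<bar>"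
    using BC_LipE[OF assms(1)] BC_LipE[OF assms(2)] by metis
  have "\<bar>(f (x, s) + g (x, s)) - (f (x, t) + g (x, t))\<bar> \<le> (L + K) * \<bar>s - t\<bar>" if "x \<in> {0..1}" for x s t
    using LK(1)[OF that, of s t] LK(2)[OF that, of s t] by (simp add: algebra_simps abs_le_iff)
  then show ?thesis by (rule BC_LipI[OF BC_add[OF assms[THEN BC_Lip_BC]]])
qed

lemma BC_Lip_mult:
  assumes "f \<in> BC_Lip" "g \<in> BC_Lip" shows "(\<lambda>p. f p * g p) \<in> BC_Lip"
proof -
  obtain L K where LK: "\<And>x s t. x \<in> {0..1} \<Longrightarrow> \<bar>f (x, s) - f (x, t)\<bar> \<le> L * \<bar>s - t\<bar>"
      "\<And>x s t. x \<in> {0..1} \<Longrightarrow> \<bar>g (x, s) - g (x, t)\<bar> \<le> K * \<bar>s - t\<bar>"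
    using BC_LipE[OF assms(1)] BC_LipE[OF assms(2)] by metis
  obtain B C where BC: "\<And>p. p \<in> Strip \<Longrightarrow> norm (f p) \<le> B" "\<And>p. p \<in> Strip \<Longrightarrow> norm (g p) \<le> C"
      "B > 0" "C > 0"
    using assms BC_Lip_BC BC_bound by metis
  have "\<bar>f (x, s) * g (x, s) - f (x, t) * g (x, t)\<bar> \<le> (B * K + C * L) * \<bar>s - t\<bar>" if x: "x \<in> {0..1}" for x s t
  proof -
    have "f (x, s) * g (x, s) - f (x, t) * g (x, t) =
        f (x, s) * (g (x, s) - g (x, t)) + g (x, t) * (f (x, s) - f (x, t))"
      by (simp add: algebra_simps)
    also have "\<bar>\<dots>\<bar> \<le> \<bar>f (x, s)\<bar> * \<bar>g (x, s) - g (x, t)\<bar> + \<bar>g (x, t)\<bar> * \<bar>f (x, s) - f (x, t)\<bar>"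
      by (simp add: abs_triangle_ineq flip: abs_mult)
    also have "\<dots> \<le> B * (K * \<bar>s - t\<bar>) + C * (L * \<bar>s - t\<bar>)"
      using BC LK x by (intro add_mono mult_mono) (auto simp: Strip_def less_imp_le)
    finally show ?thesis by (simp add: algebra_simps)
  qed
  then show ?thesis by (rule BC_LipI[OF BC_mult[OF assms[THEN BC_Lip_BC]]])
qed

lemma BC_Lip_sum: "(\<And>i. i \<in> I \<Longrightarrow> f i \<in> BC_Lip) \<Longrightarrow> (\<lambda>p. \<Sum>i\<in>I. f i p) \<in> BC_Lip"
  by (induction I rule: infinite_finite_induct) (auto intro: BC_Lip_const BC_Lip_add)

lemma BC_Lip_prod: "(\<And>i. i \<in> I \<Longrightarrow> f i \<in> BC_Lip) \<Longrightarrow> (\<lambda>p. \<Prod>i\<in>I. f i p) \<in> BC_Lip"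
  by (induction I rule: infinite_finite_induct) (auto intro: BC_Lip_const BC_Lip_mult)

lemma BC_Lip_inverse:
  assumes f: "f \<in> BC_Lip" and c: "c > 0" "\<And>p. p \<in> Strip \<Longrightarrow> c \<le> \<bar>f p\<bar>"
  shows "(\<lambda>p. inverse (f p)) \<in> BC_Lip"
proof -
  obtain L where L: "L > 0" "\<And>x s t. x \<in> {0..1} \<Longrightarrow> \<bar>f (x, s) - f (x, t)\<bar> \<le> L * \<bar>s - t\<bar>"
    using BC_LipE[OF f] by metis
  have *: "\<bar>inverse (f (x, s)) - inverse (f (x, t))\<bar> \<le> (inverse c * L * inverse c) * \<bar>s - t\<bar>"
    if x: "x \<in> {0..1}" for x s t
  proof -
    have p: "c \<le> \<bar>f (x, r)\<bar>" for r using c x by (auto simp: Strip_def)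
    have nz: "f (x, r) \<noteq> 0" and inv: "\<bar>inverse (f (x, r))\<bar> \<le> inverse c" for r
      using p[of r] c(1) by (auto simp: le_imp_inverse_le)
    have "inverse (f (x, s)) - inverse (f (x, t)) =
        inverse (f (x, s)) * (f (x, t) - f (x, s)) * inverse (f (x, t))"
      using nz[of s] nz[of t] by (simp add: field_simps)
    also have "\<bar>\<dots>\<bar> = \<bar>inverse (f (x, s))\<bar> * \<bar>f (x, t) - f (x, s)\<bar> * \<bar>inverse (f (x, t))\<bar>"
      by (simp only: abs_mult)
    also have "\<dots> \<le> inverse c * (L * \<bar>t - s\<bar>) * inverse c"
      using L c(1) by (intro mult_mono inv L x) auto
    finally show ?thesis by (simp add: mult_ac abs_minus_commute)
  qed
  show ?thesis by (rule BC_LipI[OF _ *]) (rule BC_inverse[OF BC_Lip_BC[OF f] c])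
qed

lemma BC_Lip_det:
  fixes A :: "real \<times> real \<Rightarrow> real ^ 'n ^ 'n"
  assumes "\<And>j k. (\<lambda>p. A p $ j $ k) \<in> BC_Lip"
  shows "(\<lambda>p. det (A p)) \<in> BC_Lip"
  unfolding det_def by (intro BC_Lip_sum BC_Lip_mult BC_Lip_const BC_Lip_prod assms)

section \<open>Entries of the inverse matrix\<close>

lemma matrix_inv_cancel:
  fixes A :: "real ^ 'n ^ 'n"
  assumes "invertible A"
  shows "A ** matrix_inv A = mat 1" and "matrix_inv A ** A = mat 1"
  using someI_ex[OF assms[unfolded invertible_def]] by (simp_all add: matrix_inv_def)

text \<open>Cramer's rule for the equation A w = e_k, whose solution is column k of the inverse. It
  exhibits the entries as quotients of polynomials in the entries of A, to which Lipschitz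
  continuity carries over.\<close>

lemma matrix_inv_entry:
  fixes A :: "real ^ 'n ^ 'n"
  assumes "invertible A"
  shows "matrix_inv A $ j $ k =
    det (\<chi> i l. if l = j then (axis k 1 :: real ^ 'n) $ i else A $ i $ l) / det A"
proof -
  have "A *v (matrix_inv A *v axis k 1) = axis k 1"
    by (simp add: matrix_vector_mul_assoc matrix_inv_cancel(1)[OF assms])
  then have "matrix_inv A *v axis k 1 =
      (\<chi> j. det (\<chi> i l. if l = j then (axis k 1 :: real ^ 'n) $ i else A $ i $ l) / det A)"
    using cramer[of A] assms invertible_det_nz[of A] by blast
  moreover have "(matrix_inv A *v axis k 1) $ j = matrix_inv A $ j $ k"
    by (simp add: matrix_vector_mult_basis column_def)
  ultimately show ?thesis by simp
qed

lemma BC_Lip_matrix_inv: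
  fixes A :: "real \<times> real \<Rightarrow> real ^ 'n ^ 'n"
  assumes A: "\<And>j k. (\<lambda>p. A p $ j $ k) \<in> BC_Lip" and inv: "\<And>p. p \<in> Strip \<Longrightarrow> invertible (A p)"
    and c: "c > 0" "\<And>p. p \<in> Strip \<Longrightarrow> c \<le> \<bar>det (A p)\<bar>"
  shows "(\<lambda>p. matrix_inv (A p) $ j $ k) \<in> BC_Lip"
proof (rule BC_Lip_cong)
  show "(\<lambda>p. det (\<chi> i l. if l = j then (axis k 1 :: real ^ 'n) $ i else A p $ i $ l)
      * inverse (det (A p))) \<in> BC_Lip"
  proof (intro BC_Lip_mult BC_Lip_det BC_Lip_inverse[OF _ c] A)
    show "(\<lambda>p. (\<chi> i l. if l = j then (axis k 1 :: real ^ 'n) $ i else A p $ i $ l) $ i $ l) \<in> BC_Lip" for i l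
      by (cases "l = j") (auto intro: BC_Lip_const A)
  qed
qed (simp add: matrix_inv_entry[OF inv] divide_inverse)

text \<open>Mean value inequality in t, with a bound of the time derivative as Lipschitz
  constant.\<close>

lemma BC1_BC_Lip:
  assumes "f \<in> BC1" shows "f \<in> BC_Lip"
proof -
  obtain L where L: "\<And>p. p \<in> Strip \<Longrightarrow> norm (pd_t f p) \<le> L"
    using assms BC_bound[of "pd_t f" Strip] unfolding BC1_def by blast
  have "\<bar>f (x, s) - f (x, t)\<bar> \<le> L * \<bar>s - t\<bar>" if x: "x \<in> {0..1}" for x s t
  proof -
    have "norm (f (x, s) - f (x, t)) \<le> L * norm (s - t)"
    proof (rule field_differentiable_bound[of UNIV "\<lambda>r. f (x, r)" "\<lambda>r. pd_t f (x, r)"])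
      fix r :: real
      have "(\<lambda>s. f (x, s)) differentiable (at r)"
        using assms x unfolding BC1_def Strip_def by auto
      then show "((\<lambda>r. f (x, r)) has_real_derivative pd_t f (x, r)) (at r)"
        unfolding pd_t_def has_real_derivative_iff_has_vector_derivative
        by (simp add: vector_derivative_works)
      show "norm (pd_t f (x, r)) \<le> L" using L x by (auto simp: Strip_def)
    qed auto
    then show ?thesis by simp
  qed
  then show ?thesis using assms by (intro BC_LipI) (auto simp: BC1_def)
qed

section \<open>Derivatives of matrix-valued functions\<close>

lemma has_vector_derivative_vec:
  fixes f :: "real \<Rightarrow> 'b::real_normed_vector ^ 'n"
  assumes "\<And>j. ((\<lambda>s. f s $ j) has_vector_derivative D $ j) (at x within S)"
  shows "(f has_vector_derivative D) (at x within S)"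
  unfolding has_vector_derivative_def has_derivative_within
proof (intro conjI vec_tendstoI)
  show "((\<lambda>y. ((1 / norm (y - x)) *\<^sub>R (f y - (f x + (y - x) *\<^sub>R D))) $ j) \<longlongrightarrow> 0 $ j) (at x within S)" for j
    using assms[of j] unfolding has_vector_derivative_def has_derivative_within by simp
qed (rule bounded_linear_scaleR_left)

text \<open>\<open>diag_b\<close> differentiates the matrix function as a whole, while (L) speaks of
  its entries. Differentiability of all entries is what makes the matrix derivative more than an
  arbitrary choice.\<close>

lemma pd_t_entry:
  fixes q :: "real \<times> real \<Rightarrow> real ^ 'n ^ 'm"
  assumes q: "\<And>j k. (\<lambda>p. q p $ j $ k) \<in> BC1" and p: "p \<in> Strip"
  shows "pd_t q p $ j $ k = pd_t (\<lambda>p. q p $ j $ k) p"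
proof -
  let ?D = "\<chi> j k. pd_t (\<lambda>p. q p $ j $ k) p"
  have "((\<lambda>s. q (fst p, s)) has_vector_derivative ?D) (at (snd p))"
  proof (intro has_vector_derivative_vec)
    fix j k
    have "(\<lambda>s. q (fst p, s) $ j $ k) differentiable (at (snd p))"
      using q[of j k] p unfolding BC1_def by (cases p) auto
    then show "((\<lambda>s. q (fst p, s) $ j $ k) has_vector_derivative ?D $ j $ k) (at (snd p))"
      by (simp add: pd_t_def vector_derivative_works)
  qed
  then show ?thesis unfolding pd_t_def[of q] by (simp add: vector_derivative_at)
qed

lemma pd_x_entry:
  fixes q :: "real \<times> real \<Rightarrow> real ^ 'n ^ 'm"
  assumes q: "\<And>j k. (\<lambda>p. q p $ j $ k) \<in> BC1" and p: "p \<in> Strip"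
  shows "pd_x q p $ j $ k = pd_x (\<lambda>p. q p $ j $ k) p"
proof -
  let ?D = "\<chi> j k. pd_x (\<lambda>p. q p $ j $ k) p"
  have "((\<lambda>s. q (s, snd p)) has_vector_derivative ?D) (at (fst p) within {0..1})"
  proof (intro has_vector_derivative_vec)
    fix j k
    have "(\<lambda>s. q (s, snd p) $ j $ k) differentiable (at (fst p) within {0..1})"
      using q[of j k] p unfolding BC1_def by (cases p) auto
    then show "((\<lambda>s. q (s, snd p) $ j $ k) has_vector_derivative ?D $ j $ k) (at (fst p) within {0..1})"
      by (simp add: pd_x_def vector_derivative_works)
  qed
  \<comment> \<open>On the boundary lines the derivative is one-sided; it is unique since
    \<open>{0..1}\<close> is a nondegenerate interval.\<close>
  then have "pd_x q p = ?D" unfolding pd_x_def[of q]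
    using p by (intro vector_derivative_within_closed_interval) (auto simp: Strip_def)
  then show ?thesis by simp
qed

section \<open>The maximum norm\<close>

lemma BC_norm_upper:
  fixes u :: "'a::topological_space \<Rightarrow> real ^ 'n"
  assumes "u \<in> BC S" "p \<in> S" shows "\<bar>u p $ j\<bar> \<le> BC_norm S u"
proof -
  obtain B where B: "\<And>p. p \<in> S \<Longrightarrow> norm (u p) \<le> B" using BC_bound[OF assms(1)] by metis
  have "bdd_above {\<bar>u p $ j\<bar> |p j. p \<in> S}"
    by (rule bdd_aboveI[where M=B]) (auto intro: order.trans[OF component_le_norm_cart B])
  then show ?thesis unfolding BC_norm_def by (rule cSup_upper[rotated]) (use assms in auto)
qed

lemma BC_norm_least:
  fixes u :: "'a \<Rightarrow> real ^ 'n"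
  assumes "S \<noteq> {}" "\<And>p j. p \<in> S \<Longrightarrow> \<bar>u p $ j\<bar> \<le> B" shows "BC_norm S u \<le> B"
  unfolding BC_norm_def
proof (rule cSup_least)
  obtain p where "p \<in> S" using assms(1) by auto
  then have "\<bar>u p $ undefined\<bar> \<in> {\<bar>u p $ j\<bar> |p j. p \<in> S}" by blast
  then show "{\<bar>u p $ j\<bar> |p j. p \<in> S} \<noteq> {}" by blast
qed (use assms in auto)

lemma BC_norm_nonneg:
  fixes u :: "'a::topological_space \<Rightarrow> real ^ 'n"
  assumes "u \<in> BC S" "S \<noteq> {}" shows "0 \<le> BC_norm S u"
proof -
  obtain p where "p \<in> S" using assms by auto
  then show ?thesis using order.trans[OF abs_ge_zero BC_norm_upper[OF assms(1)]] by blast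
qed

section \<open>The integral operator along characteristics\<close>

text \<open>Bounding \<open>(y - x) * g \<eta>\<close> instead of \<open>g \<eta>\<close> puts the
  orientation into the hypothesis, so one statement serves both directions of propagation.\<close>

lemma segment_integral_le:
  fixes g :: "real \<Rightarrow> real"
  assumes g: "continuous_on {l..u} g" and x: "x \<in> {l..u}" and y: "y \<in> {l..u}"
    and C: "\<And>\<eta>. \<eta> \<in> {l..u} \<Longrightarrow> (y - x) * g \<eta> \<le> C"
  shows "(LBINT \<eta>=x..y. g \<eta>) \<le> C"
proof -
  have line: "x + s * (y - x) \<in> {l..u}" if "s \<in> {0..1}" for s
    using x y that convexD_alt[of "{l..u}" x y s] by (simp add: algebra_simps)
  have "(LBINT \<eta>=x..y. g \<eta>) = integral {0..1} (\<lambda>s. (y - x) * g (x + s * (y - x)))"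
    unfolding segment_integral(1)[OF g x y] by (rule integral_mult_right[symmetric])
  also have "\<dots> \<le> integral {0..1} (\<lambda>s::real. C)"
    by (rule integral_le)
       (use segment_integral(2)[OF g x y] line C in \<open>auto intro: integrable_on_mult_right\<close>)
  finally show ?thesis by simp
qed

text \<open>Over the fixed interval \<open>{0..1}\<close> the moving end points become parameters of
  the integrand, and continuity of parameter integrals applies.\<close>

lemma segment_integral_continuous_param:
  fixes G :: "real \<times> 'p::topological_space \<Rightarrow> real" and X Y :: "'q::topological_space \<Rightarrow> real"
  assumes G: "continuous_on ({l..u} \<times> S) G" and X: "continuous_on T X" and Y: "continuous_on T Y"
    and r: "continuous_on T r"
    and in_dom: "\<And>z. z \<in> T \<Longrightarrow> X z \<in> {l..u}" "\<And>z. z \<in> T \<Longrightarrow> Y z \<in> {l..u}" "\<And>z. z \<in> T \<Longrightarrow> r z \<in> S"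
  shows "continuous_on T (\<lambda>z. LBINT \<eta>=X z..Y z. G (\<eta>, r z))"
proof -
  have line: "X z + s * (Y z - X z) \<in> {l..u}" if "s \<in> {0..1}" "z \<in> T" for s z
    using in_dom(1,2)[OF that(2)] that(1) convexD_alt[of "{l..u}" "X z" "Y z" s] by (simp add: algebra_simps)
  have "continuous_on T (\<lambda>z. (Y z - X z) * integral (cbox 0 1) (\<lambda>s. G (X z + s * (Y z - X z), r z)))"
  proof (intro continuous_intros integral_continuous_on_param X Y)
    have fst: "continuous_on (T \<times> {0..1}) (\<lambda>x::'q \<times> real. f (fst x))" if "continuous_on T f"
      for f :: "'q \<Rightarrow> 'c::topological_space"
      by (rule continuous_on_compose2[OF that]) (auto intro!: continuous_intros)
    have "continuous_on (T \<times> {0..1})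
        (\<lambda>x. G (X (fst x) + snd x * (Y (fst x) - X (fst x)), r (fst x)))"
      by (rule continuous_on_compose2[OF G])
         (use line in_dom in \<open>auto intro!: continuous_intros fst X Y r\<close>)
    then show "continuous_on (T \<times> cbox 0 1) (\<lambda>(z, s). G (X z + s * (Y z - X z), r z))"
      by (simp add: case_prod_beta)
  qed
  then show ?thesis
  proof (rule continuous_on_eq)
    fix z assume z: "z \<in> T"
    have "continuous_on {l..u} (\<lambda>\<eta>. G (\<eta>, r z))"
      by (rule continuous_on_compose2[OF G]) (use in_dom(3)[OF z] in \<open>auto intro!: continuous_intros\<close>)
    from segment_integral(1)[OF this in_dom(1,2)[OF z]]
    show "(Y z - X z) * integral (cbox 0 1) (\<lambda>s. G (X z + s * (Y z - X z), r z)) =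
        (LBINT \<eta>=X z..Y z. G (\<eta>, r z))" by simp
  qed
qed

section \<open>Characteristics and the coefficients along them\<close>

text \<open>The diagonalised system on its own: \<open>b\<close> stands for \<open>diag_b\<close>,
  and \<open>l\<close> bounds all speeds away from zero, which keeps the slopes 1/a_j of the
  characteristics bounded and Lipschitz.\<close>

locale hyperbolic_system =
  fixes m :: nat and a :: "('n::{finite,linorder}) vec_field" and b :: "'n mat_field" and l :: real
  assumes a_Lip: "\<And>j. (\<lambda>p. a p $ j) \<in> BC_Lip"
    and l_pos: "l > 0"
    and a_away: "\<And>p j. p \<in> Strip \<Longrightarrow> l \<le> \<bar>a p $ j\<bar>"
    and a_pos: "\<And>p j. p \<in> Strip \<Longrightarrow> idx j \<le> m \<Longrightarrow> a p $ j > 0"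
    and a_neg: "\<And>p j. p \<in> Strip \<Longrightarrow> idx j > m \<Longrightarrow> a p $ j < 0"
    and b_BC: "b \<in> BC Strip"
begin

lemma a_nz: "p \<in> Strip \<Longrightarrow> a p $ j \<noteq> 0"
  using a_away[of p j] l_pos by auto

lemma slowness_Lip: "(\<lambda>p. 1 / a p $ j) \<in> BC_Lip"
  using BC_Lip_inverse[OF a_Lip[of j] l_pos a_away] by (simp add: inverse_eq_divide)

lemma b_entry_BC: "(\<lambda>p. b p $ j $ k) \<in> BC Strip"
  using b_BC by (auto simp: BC_vec_iff)

lemma b_over_a_BC: "(\<lambda>p. b p $ j $ k / a p $ i) \<in> BC Strip"
  by (rule BC_divide[OF b_entry_BC BC_Lip_BC[OF a_Lip] l_pos a_away])

text \<open>\<open>omega\<close> is a choice by \<open>SOME\<close>, so all its properties rest on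
  existence. With the space variable as the independent one, the slope 1/a_j is bounded and
  Lipschitz in t, so a solution exists on all of \<open>{0..1}\<close>.\<close>

lemma omega_is_characteristic:
  assumes "x \<in> {0..1}" shows "is_characteristic a j x t (\<lambda>\<xi>. omega a j \<xi> x t)"
proof -
  obtain L where L: "L > 0" "\<And>\<xi> s t. \<xi> \<in> {0..1} \<Longrightarrow> \<bar>1 / a (\<xi>, s) $ j - 1 / a (\<xi>, t) $ j\<bar> \<le> L * \<bar>s - t\<bar>"
    using BC_LipE[OF slowness_Lip[of j]] by metis
  obtain B where B: "\<And>p. p \<in> Strip \<Longrightarrow> norm (1 / a p $ j) \<le> B"
    using BC_bound[OF BC_Lip_BC[OF slowness_Lip[of j]]] by metis
  have "\<exists>w. (\<forall>\<xi>\<in>{0..1}. (w has_real_derivative 1 / a (\<xi>, w \<xi>) $ j) (at \<xi> within {0..1})) \<and> w x = t"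
    by (rule ode_solution_exists[where f="\<lambda>p. 1 / a p $ j" and B=B and L=L])
       (use assms L B BC_continuous[OF BC_Lip_BC[OF slowness_Lip[of j]]] in \<open>auto simp: Strip_def\<close>)
  then have "\<exists>w. is_characteristic a j x t w" unfolding is_characteristic_def .
  from someI_ex[OF this] show ?thesis unfolding omega_def .
qed

lemma omega_derivative:
  "x \<in> {0..1} \<Longrightarrow> \<xi> \<in> {0..1} \<Longrightarrow>
    ((\<lambda>\<xi>. omega a j \<xi> x t) has_real_derivative 1 / a (\<xi>, omega a j \<xi> x t) $ j) (at \<xi> within {0..1})"
  using omega_is_characteristic by (simp add: is_characteristic_def)

lemma omega_start: "x \<in> {0..1} \<Longrightarrow> omega a j x x t = t"
  using omega_is_characteristic by (simp add: is_characteristic_def)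

text \<open>Two characteristics are compared at the abscissa x where the first one starts. There
  they differ by at most |t - s| + B |x - y|, as the second moves with slope at most B; the Gronwall
  bound carries this to \<xi> at the cost of a factor exp L, since |\<xi> - x| is at most 1.\<close>

lemma omega_continuous:
  "continuous_on ({0..1} \<times> Strip) (\<lambda>z. omega a j (fst z) (fst (snd z)) (snd (snd z)))"
proof -
  obtain L where L: "L > 0" "\<And>\<xi> s t. \<xi> \<in> {0..1} \<Longrightarrow> \<bar>1 / a (\<xi>, s) $ j - 1 / a (\<xi>, t) $ j\<bar> \<le> L * \<bar>s - t\<bar>"
    using BC_LipE[OF slowness_Lip[of j]] by metis
  obtain B where B: "B > 0" "\<And>p. p \<in> Strip \<Longrightarrow> norm (1 / a p $ j) \<le> B"
    using BC_bound[OF BC_Lip_BC[OF slowness_Lip[of j]]] by metis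
  have Lip: "\<bar>omega a j \<xi> x t - omega a j \<zeta> x t\<bar> \<le> B * \<bar>\<xi> - \<zeta>\<bar>"
    if "x \<in> {0..1}" "\<xi> \<in> {0..1}" "\<zeta> \<in> {0..1}" for \<xi> \<zeta> x t
    using field_differentiable_bound[of "{0..1}" "\<lambda>\<xi>. omega a j \<xi> x t"
        "\<lambda>\<xi>. 1 / a (\<xi>, omega a j \<xi> x t) $ j" B \<xi> \<zeta>] omega_derivative[OF that(1)] B that
    by (auto simp: Strip_def)
  have main: "\<bar>omega a j \<xi> x t - omega a j \<zeta> y s\<bar> \<le> (exp L * (1 + B) + B) * (\<bar>\<xi> - \<zeta>\<bar> + \<bar>x - y\<bar> + \<bar>t - s\<bar>)"
    if "x \<in> {0..1}" "y \<in> {0..1}" "\<xi> \<in> {0..1}" "\<zeta> \<in> {0..1}" for \<xi> \<zeta> x y t s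
  proof -
    have "\<bar>omega a j \<xi> x t - omega a j \<xi> y s\<bar> \<le> exp (L * \<bar>\<xi> - x\<bar>) * \<bar>omega a j x x t - omega a j x y s\<bar>"
      by (rule ode_solution_dependence[where f="\<lambda>p. 1 / a p $ j" and l=0 and u=1])
         (use that omega_derivative L in auto)
    also have "\<dots> \<le> exp L * (\<bar>t - s\<bar> + B * \<bar>x - y\<bar>)"
    proof (intro mult_mono)
      have "L * \<bar>\<xi> - x\<bar> \<le> L * 1" using that L by (intro mult_left_mono) auto
      then show "exp (L * \<bar>\<xi> - x\<bar>) \<le> exp L" by simp
      show "\<bar>omega a j x x t - omega a j x y s\<bar> \<le> \<bar>t - s\<bar> + B * \<bar>x - y\<bar>"
        using Lip[of y y x s] that by (simp add: omega_start abs_minus_commute)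
    qed auto
    finally have 1: "\<bar>omega a j \<xi> x t - omega a j \<xi> y s\<bar> \<le> exp L * (\<bar>t - s\<bar> + B * \<bar>x - y\<bar>)" .
    have "\<bar>omega a j \<xi> x t - omega a j \<zeta> y s\<bar> \<le> exp L * (\<bar>t - s\<bar> + B * \<bar>x - y\<bar>) + B * \<bar>\<xi> - \<zeta>\<bar>"
      using 1 Lip[of y \<xi> \<zeta> s] that by linarith
    also have "\<dots> \<le> exp L * ((1 + B) * (\<bar>\<xi> - \<zeta>\<bar> + \<bar>x - y\<bar> + \<bar>t - s\<bar>)) + B * (\<bar>\<xi> - \<zeta>\<bar> + \<bar>x - y\<bar> + \<bar>t - s\<bar>)"
      using B(1) by (intro add_mono mult_left_mono) (auto simp: algebra_simps intro: add_nonneg_nonneg)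
    finally show ?thesis by (simp add: algebra_simps)
  qed
  \<comment> \<open>The factor 3 passes from the sum of three coordinate differences to the product
    metric, which dominates each of them.\<close>
  have "(3 * (exp L * (1 + B) + B))-lipschitz_on ({0..1} \<times> Strip)
      (\<lambda>z. omega a j (fst z) (fst (snd z)) (snd (snd z)))"
  proof (rule lipschitz_onI)
    fix z w :: "real \<times> real \<times> real" assume zw: "z \<in> {0..1} \<times> Strip" "w \<in> {0..1} \<times> Strip"
    obtain \<xi> x t \<zeta> y s where eq: "z = (\<xi>, x, t)" "w = (\<zeta>, y, s)" by (metis surj_pair)
    have d: "dist \<xi> \<zeta> \<le> dist z w" "dist (x, t) (y, s) \<le> dist z w"
      "dist x y \<le> dist (x, t) (y, s)" "dist t s \<le> dist (x, t) (y, s)"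
      using dist_fst_le[of z w] dist_snd_le[of z w] dist_fst_le[of "(x, t)" "(y, s)"]
        dist_snd_le[of "(x, t)" "(y, s)"] by (auto simp: eq)
    have "\<bar>omega a j \<xi> x t - omega a j \<zeta> y s\<bar> \<le> (exp L * (1 + B) + B) * (\<bar>\<xi> - \<zeta>\<bar> + \<bar>x - y\<bar> + \<bar>t - s\<bar>)"
      using zw by (intro main) (auto simp: eq Strip_def)
    also have "\<dots> \<le> (exp L * (1 + B) + B) * (3 * dist z w)"
      using d B(1) by (intro mult_left_mono) (auto simp: dist_real_def)
    finally show "dist (omega a j (fst z) (fst (snd z)) (snd (snd z))) (omega a j (fst w) (fst (snd w)) (snd (snd w)))
        \<le> 3 * (exp L * (1 + B) + B) * dist z w"
      by (simp add: eq dist_real_def algebra_simps)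
  qed (use B(1) in auto)
  then show ?thesis by (rule lipschitz_on_continuous_on)
qed

lemma along_characteristic_continuous:
  fixes F :: "real \<times> real \<Rightarrow> 'c::topological_space"
  assumes "continuous_on Strip F"
  shows "continuous_on ({0..1} \<times> Strip) (\<lambda>z. F (fst z, omega a j (fst z) (fst (snd z)) (snd (snd z))))"
proof (rule continuous_on_compose2[OF assms])
  show "continuous_on ({0..1} \<times> Strip) (\<lambda>z. (fst z, omega a j (fst z) (fst (snd z)) (snd (snd z))))"
    by (intro continuous_intros omega_continuous)
qed (auto simp: Strip_def)

lemma c_coef_continuous:
  "continuous_on ({0..1} \<times> Strip) (\<lambda>z. c_coef a b j (fst z) (fst (snd z)) (snd (snd z)))"
  unfolding c_coef_def
proof (rule continuous_on_exp)
  show "continuous_on ({0..1} \<times> Strip) (\<lambda>z::real \<times> real \<times> real. LBINT \<eta>=fst (snd z)..fst z.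
      b (\<eta>, omega a j \<eta> (fst (snd z)) (snd (snd z))) $ j $ j /
      a (\<eta>, omega a j \<eta> (fst (snd z)) (snd (snd z))) $ j)"
    using segment_integral_continuous_param[OF along_characteristic_continuous[OF
          BC_continuous[OF b_over_a_BC[of j j j]], of j],
        of "{0..1} \<times> Strip" "\<lambda>z. fst (snd z)" fst snd]
    by (force intro!: continuous_intros simp: Strip_def)
qed

lemma d_coef_continuous:
  "continuous_on ({0..1} \<times> Strip) (\<lambda>z. d_coef a b j (fst z) (fst (snd z)) (snd (snd z)))"
  unfolding d_coef_def
  using along_characteristic_continuous[OF BC_continuous[OF BC_Lip_BC[OF a_Lip[of j]]], of j]
  by (intro continuous_on_divide c_coef_continuous) (auto simp: Strip_def intro!: a_nz)

lemma x_end_01: "x_end m j \<in> {0..1}"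
  by (simp add: x_end_def)

section \<open>The integral operator\<close>

text \<open>The integrand of the integral system as a function of the triple (\<xi>, x, t), the form
  in which joint continuity and parameter integrals are available.\<close>

definition source :: "'n \<Rightarrow> 'n vec_field \<Rightarrow> 'n vec_field \<Rightarrow> real \<times> real \<times> real \<Rightarrow> real" where
  "source j u g z = (let p = (fst z, omega a j (fst z) (fst (snd z)) (snd (snd z))) in
     d_coef a b j (fst z) (fst (snd z)) (snd (snd z)) *
       ((\<Sum>k\<in>UNIV - {j}. b p $ j $ k * u p $ k) - g p $ j))"

text \<open>The right-hand side of the integral system, with \<open>r\<close> in place of \<open>Rz + h\<close> and \<open>g\<close> in place of
  \<open>q\<^sup>-\<^sup>1g\<close>.\<close>

definition char_op :: "(real \<Rightarrow> (real, 'n) vec) \<Rightarrow> 'n vec_field \<Rightarrow> 'n vec_field \<Rightarrow> 'n vec_field" where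
  "char_op r u g p = (\<chi> j. c_coef a b j (x_end m j) (fst p) (snd p) *
       r (omega a j (x_end m j) (fst p) (snd p)) $ j
     - (LBINT \<xi>=x_end m j..fst p. source j u g (\<xi>, p)))"

lemma source_continuous:
  assumes "u \<in> BC Strip" "g \<in> BC Strip"
  shows "continuous_on ({0..1} \<times> Strip) (source j u g)"
proof -
  have 1: "continuous_on Strip (\<lambda>p. (\<Sum>k\<in>UNIV - {j}. b p $ j $ k * u p $ k) - g p $ j)"
    using assms by (intro BC_continuous BC_diff BC_sum BC_mult b_entry_BC) (auto simp: BC_vec_iff)
  show ?thesis
    unfolding source_def Let_def
    by (intro continuous_intros d_coef_continuous along_characteristic_continuous[OF 1, of j])
qed

lemma source_continuous_section:
  assumes "u \<in> BC Strip" "g \<in> BC Strip" "p \<in> Strip"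
  shows "continuous_on {0..1} (\<lambda>\<xi>. source j u g (\<xi>, p))"
  by (rule continuous_on_compose2[OF source_continuous[OF assms(1,2)]])
     (use assms(3) in \<open>auto intro!: continuous_intros\<close>)

text \<open>Joint linearity in the boundary data, the unknown and the source, in the difference form
  used for contraction and uniqueness. Membership in \<open>BC Strip\<close> makes the integrands
  continuous, so that the integrals subtract.\<close>

lemma char_op_diff:
  assumes "u \<in> BC Strip" "g \<in> BC Strip" "u' \<in> BC Strip" "g' \<in> BC Strip" "p \<in> Strip"
  shows "char_op (\<lambda>t. r t - r' t) (\<lambda>p. u p - u' p) (\<lambda>p. g p - g' p) p = char_op r u g p - char_op r' u' g' p"
proof -
  have src: "source j (\<lambda>p. u p - u' p) (\<lambda>p. g p - g' p) z = source j u g z - source j u' g' z" for j z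
    by (simp add: source_def Let_def algebra_simps sum_subtractf)
  have "(LBINT \<xi>=x_end m j..fst p. source j u g (\<xi>, p) - source j u' g' (\<xi>, p)) =
      (LBINT \<xi>=x_end m j..fst p. source j u g (\<xi>, p)) - (LBINT \<xi>=x_end m j..fst p. source j u' g' (\<xi>, p))" for j
    by (rule segment_integral_diff[OF source_continuous_section source_continuous_section x_end_01])
       (use assms in \<open>auto simp: Strip_def\<close>)
  then show ?thesis by (simp add: char_op_def vec_eq_iff src algebra_simps)
qed

text \<open>The integration runs between \<open>x_end m j\<close> and \<open>fst p\<close>, both in
  \<open>{0..1}\<close>, so the characteristic is only followed inside the strip. This matters
  because q and its inverse cancel only there.\<close>

lemma char_op_cong:
  assumes "\<And>p. p \<in> Strip \<Longrightarrow> u p = u' p" "\<And>p. p \<in> Strip \<Longrightarrow> g p = g' p" and p: "p \<in> Strip"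
  shows "char_op r u g p = char_op r u' g' p"
proof -
  have "(LBINT \<xi>=x_end m j..fst p. source j u g (\<xi>, p)) = (LBINT \<xi>=x_end m j..fst p. source j u' g' (\<xi>, p))" for j
  proof (rule interval_integral_cong)
    fix \<xi> :: real assume "\<xi> \<in> einterval (min (ereal (x_end m j)) (ereal (fst p))) (max (ereal (x_end m j)) (ereal (fst p)))"
    then have "\<xi> \<in> {0..1}"
      using x_end_01[of j] p by (auto simp: einterval_def min_def max_def Strip_def split: if_splits)
    then show "source j u g (\<xi>, p) = source j u' g' (\<xi>, p)"
      using assms by (simp add: source_def Let_def Strip_def)
  qed
  then show ?thesis by (simp add: char_op_def)
qed

section \<open>Estimates by gamma_j and beta_j\<close>

lemma gam_le:
  assumes "p \<in> Strip" shows "gam a b j * \<bar>a p $ j\<bar> \<le> b p $ j $ j"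
proof -
  obtain B where B: "\<And>p. p \<in> Strip \<Longrightarrow> norm (b p $ j $ j / a p $ j) \<le> B"
    using BC_bound[OF b_over_a_BC[of j j j]] by metis
  have "- B \<le> b p $ j $ j / \<bar>a p $ j\<bar>" if "p \<in> Strip" for p
    using B[OF that] by (auto simp: abs_if split: if_splits)
  then have "bdd_below ((\<lambda>p. b p $ j $ j / \<bar>a p $ j\<bar>) ` Strip)" by (intro bdd_belowI2)
  then have "gam a b j \<le> b p $ j $ j / \<bar>a p $ j\<bar>"
    unfolding gam_def using assms by (rule cINF_lower)
  then show ?thesis using a_nz[OF assms, of j] by (simp add: pos_le_divide_eq)
qed

lemma bet_ge:
  assumes "p \<in> Strip" shows "(\<Sum>k\<in>UNIV - {j}. \<bar>b p $ j $ k / a p $ j\<bar>) \<le> bet a b j"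
proof -
  have "\<exists>B. \<forall>p\<in>Strip. norm (b p $ j $ k / a p $ j) \<le> B" for k
    using BC_bound[OF b_over_a_BC[of j k j]] by metis
  then obtain B where B: "\<And>k p. p \<in> Strip \<Longrightarrow> norm (b p $ j $ k / a p $ j) \<le> B k" by metis
  have "bdd_above ((\<lambda>p. \<Sum>k\<in>UNIV - {j}. \<bar>b p $ j $ k / a p $ j\<bar>) ` Strip)"
    by (rule bdd_aboveI2[where M="\<Sum>k\<in>UNIV - {j}. B k"]) (use B in \<open>auto intro!: sum_mono\<close>)
  then show ?thesis unfolding bet_def using assms by (intro cSUP_upper)
qed

lemma bet_nonneg: "0 \<le> bet a b j"
proof -
  have "0 \<le> (\<Sum>k\<in>UNIV - {j}. \<bar>b (0, 0) $ j $ k / a (0, 0) $ j\<bar>)" by (intro sum_nonneg) auto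
  also have "\<dots> \<le> bet a b j" by (rule bet_ge) (auto simp: Strip_def)
  finally show ?thesis .
qed

text \<open>Going from x towards the incoming boundary, \<xi> - x has the sign opposite to a_j (or
  vanishes), so (\<xi> - x) b_jj / a_j equals -|\<xi> - x| b_jj / |a_j|, which is at most -gamma_j
  |\<xi> - x|. In the other direction gamma_j would give a lower bound instead.\<close>

lemma c_coef_bound:
  assumes p: "p \<in> Strip" and \<xi>: "\<xi> \<in> closed_segment (fst p) (x_end m j)"
  shows "c_coef a b j \<xi> (fst p) (snd p) \<le> exp (- gam a b j * \<bar>\<xi> - fst p\<bar>)"
proof -
  let ?\<omega> = "\<lambda>\<eta>. (\<eta>, omega a j \<eta> (fst p) (snd p))"
  have \<xi>01: "\<xi> \<in> {0..1}" and x01: "fst p \<in> {0..1}"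
    using \<xi> p x_end_01[of j] by (auto simp: Strip_def closed_segment_eq_real_ivl split: if_splits)
  have "continuous_on {0..1} (\<lambda>\<eta>. b (?\<omega> \<eta>) $ j $ j / a (?\<omega> \<eta>) $ j)"
    using continuous_on_compose2[OF along_characteristic_continuous[OF
          BC_continuous[OF b_over_a_BC[of j j j]], of j], of "{0..1}" "\<lambda>\<eta>. (\<eta>, p)"] p
    by (force intro!: continuous_intros)
  moreover have "(\<xi> - fst p) * (b (?\<omega> \<eta>) $ j $ j / a (?\<omega> \<eta>) $ j) \<le> - gam a b j * \<bar>\<xi> - fst p\<bar>"
    if \<eta>: "\<eta> \<in> {0..1}" for \<eta>
  proof -
    let ?\<phi> = "b (?\<omega> \<eta>) $ j $ j / a (?\<omega> \<eta>) $ j"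
    have S: "?\<omega> \<eta> \<in> Strip" using \<eta> by (simp add: Strip_def)
    show ?thesis
    proof (cases "idx j \<le> m")
      case True
      then have "gam a b j \<le> ?\<phi>" and "\<xi> \<le> fst p"
        using gam_le[OF S, of j] a_pos[OF S True] \<xi> x01
        by (auto simp: pos_le_divide_eq x_end_def closed_segment_eq_real_ivl split: if_splits)
      then show ?thesis using mult_left_mono_neg[of "gam a b j" ?\<phi> "\<xi> - fst p"]
        by (simp add: algebra_simps)
    next
      case False
      then have "?\<phi> \<le> - gam a b j" and "fst p \<le> \<xi>"
        using gam_le[OF S, of j] a_neg[OF S, of j] \<xi> x01
        by (auto simp: neg_divide_le_eq x_end_def closed_segment_eq_real_ivl split: if_splits)
      then show ?thesis using mult_left_mono[of ?\<phi> "- gam a b j" "\<xi> - fst p"]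
        by (simp add: algebra_simps)
    qed
  qed
  ultimately show ?thesis
    unfolding c_coef_def exp_le_cancel_iff using x01 \<xi>01 by (intro segment_integral_le[where l=0 and u=1])
qed

lemma char_op_bound:
  assumes p: "p \<in> Strip" and u: "u \<in> BC Strip" and g: "g \<in> BC Strip"
    and r: "\<And>t. \<bar>r t $ j\<bar> \<le> \<rho>" and U: "\<And>p k. p \<in> Strip \<Longrightarrow> \<bar>u p $ k\<bar> \<le> U"
    and G: "\<And>p. p \<in> Strip \<Longrightarrow> \<bar>g p $ j / a p $ j\<bar> \<le> G"
  defines "s \<equiv> \<bar>fst p - x_end m j\<bar>"
  shows "\<bar>char_op r u g p $ j\<bar> \<le> exp (- gam a b j * s) * \<rho> + (bet a b j * U + G) * decay_int (gam a b j) s"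
proof -
  have x01: "fst p \<in> {0..1}" using p by (auto simp: Strip_def)
  \<comment> \<open>The integral is taken from p to the incoming boundary, because the decay is
    measured from the starting point; the orientation is reversed afterwards.\<close>
  have "\<bar>LBINT \<xi>=fst p..x_end m j. source j u g (\<xi>, p)\<bar> \<le>
      (bet a b j * U + G) * decay_int (gam a b j) \<bar>x_end m j - fst p\<bar>"
  proof (rule segment_integral_bound[OF source_continuous_section[OF u g p] x01 x_end_01])
    fix \<xi> :: real assume \<xi>: "\<xi> \<in> {0..1}" "\<xi> \<in> closed_segment (fst p) (x_end m j)"
    let ?P = "(\<xi>, omega a j \<xi> (fst p) (snd p))"
    have P: "?P \<in> Strip" using \<xi> by (simp add: Strip_def)
    \<comment> \<open>The factor 1/a_j of d_j moves onto the coefficients: c_j alone remains to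
      supply the decay, the quotients b_jk / a_j sum to at most beta_j in absolute value, and g
      enters as g_j / a_j.\<close>
    let ?E = "(\<Sum>k\<in>UNIV - {j}. b ?P $ j $ k / a ?P $ j * u ?P $ k) - g ?P $ j / a ?P $ j"
    have "?E = ((\<Sum>k\<in>UNIV - {j}. b ?P $ j $ k * u ?P $ k) - g ?P $ j) / a ?P $ j"
      by (simp add: diff_divide_distrib sum_divide_distrib)
    then have "source j u g (\<xi>, p) = c_coef a b j \<xi> (fst p) (snd p) * ?E"
      by (simp add: source_def Let_def d_coef_def)
    then have "\<bar>source j u g (\<xi>, p)\<bar> = c_coef a b j \<xi> (fst p) (snd p) * \<bar>?E\<bar>"
      by (simp only: abs_mult) (simp add: c_coef_def)
    also have "\<dots> \<le> exp (- gam a b j * \<bar>\<xi> - fst p\<bar>) * (bet a b j * U + G)"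
    proof (rule mult_mono)
      show "c_coef a b j \<xi> (fst p) (snd p) \<le> exp (- gam a b j * \<bar>\<xi> - fst p\<bar>)"
        by (rule c_coef_bound[OF p \<xi>(2)])
      have "0 \<le> U" by (rule order.trans[OF abs_ge_zero U[OF P, of j]])
      have "\<bar>\<Sum>k\<in>UNIV - {j}. b ?P $ j $ k / a ?P $ j * u ?P $ k\<bar> \<le>
          (\<Sum>k\<in>UNIV - {j}. \<bar>b ?P $ j $ k / a ?P $ j\<bar> * U)"
        by (rule order.trans[OF sum_abs], rule sum_mono, unfold abs_mult, rule mult_left_mono)
           (simp_all add: U[OF P])
      also have "\<dots> \<le> bet a b j * U"
        unfolding sum_distrib_right[symmetric] by (intro mult_right_mono bet_ge[OF P] \<open>0 \<le> U\<close>)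
      finally show "\<bar>?E\<bar> \<le> bet a b j * U + G" using G[OF P] by linarith
    qed auto
    finally show "\<bar>source j u g (\<xi>, p)\<bar> \<le> (bet a b j * U + G) * exp (- gam a b j * \<bar>\<xi> - fst p\<bar>)"
      by (simp add: mult.commute)
  qed
  then have 1: "\<bar>LBINT \<xi>=x_end m j..fst p. source j u g (\<xi>, p)\<bar> \<le>
      (bet a b j * U + G) * decay_int (gam a b j) s"
    by (subst interval_integral_endpoints_reverse) (simp add: s_def abs_minus_commute)
  have "\<bar>c_coef a b j (x_end m j) (fst p) (snd p) * r (omega a j (x_end m j) (fst p) (snd p)) $ j\<bar> \<le>
      exp (- gam a b j * s) * \<rho>"
    using c_coef_bound[OF p, of "x_end m j" j]
    by (auto simp: abs_mult s_def abs_minus_commute c_coef_def intro!: mult_mono r)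
  with 1 show ?thesis unfolding char_op_def vec_lambda_beta by linarith
qed

lemma char_op_BC:
  assumes r: "r \<in> BC UNIV" and u: "u \<in> BC Strip" and g: "g \<in> BC Strip"
  shows "char_op r u g \<in> BC Strip"
  unfolding BC_vec_iff
proof
  fix j :: 'n
  have sec: "continuous_on Strip (\<lambda>p. F (x_end m j, p))"
    if "continuous_on ({0..1} \<times> Strip) F" for F :: "_ \<Rightarrow> real"
    by (rule continuous_on_compose2[OF that]) (use x_end_01[of j] in \<open>auto intro!: continuous_intros\<close>)
  have "continuous_on Strip (\<lambda>p. char_op r u g p $ j)"
    unfolding char_op_def vec_lambda_beta
  proof (intro continuous_on_diff continuous_on_mult)
    show "continuous_on Strip (\<lambda>p. c_coef a b j (x_end m j) (fst p) (snd p))"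
      using sec[OF c_coef_continuous[of j]] by simp
    have "continuous_on UNIV (\<lambda>t. r t $ j)"
      using r by (intro BC_continuous) (auto simp: BC_vec_iff)
    then show "continuous_on Strip (\<lambda>p. r (omega a j (x_end m j) (fst p) (snd p)) $ j)"
      by (rule continuous_on_compose2) (use sec[OF omega_continuous[of j]] in auto)
    show "continuous_on Strip (\<lambda>p. LBINT \<xi>=x_end m j..fst p. source j u g (\<xi>, p))"
      by (rule segment_integral_continuous_param[OF source_continuous[OF u g], of Strip "\<lambda>_. x_end m j" fst "\<lambda>p. p"])
         (use x_end_01[of j] in \<open>auto intro!: continuous_intros simp: Strip_def\<close>)
  qed
  moreover
  obtain \<rho> where \<rho>: "\<And>t. norm (r t) \<le> \<rho>" by (metis BC_bound[OF r] UNIV_I)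
  have \<rho>: "\<bar>r t $ k\<bar> \<le> \<rho>" for t k by (rule order.trans[OF component_le_norm_cart \<rho>])
  obtain U where U: "\<And>p. p \<in> Strip \<Longrightarrow> norm (u p) \<le> U" using BC_bound[OF u] by metis
  have U: "\<bar>u p $ k\<bar> \<le> U" if "p \<in> Strip" for p k
    by (rule order.trans[OF component_le_norm_cart U[OF that]])
  have "(\<lambda>p. g p $ j / a p $ j) \<in> BC Strip"
    using g by (intro BC_divide[OF _ BC_Lip_BC[OF a_Lip] l_pos a_away]) (auto simp: BC_vec_iff)
  from BC_bound[OF this] obtain G where G: "\<And>p. p \<in> Strip \<Longrightarrow> norm (g p $ j / a p $ j) \<le> G"
    by blast
  note G = G[unfolded real_norm_def]
  have "0 \<le> \<rho>" by (rule order.trans[OF abs_ge_zero \<rho>[of 0 j]])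
  have "0 \<le> U" by (rule order.trans[OF abs_ge_zero U[of "(0, 0)" j]]) (simp add: Strip_def)
  have "0 \<le> G" by (rule order.trans[OF abs_ge_zero G[of "(0, 0)"]]) (simp add: Strip_def)
  \<comment> \<open>gamma_j may be negative, so the bound uniform over distances in
    \<open>{0..1}\<close> uses the absolute value in the exponent.\<close>
  have "\<bar>char_op r u g p $ j\<bar> \<le> exp \<bar>gam a b j\<bar> * \<rho> + (bet a b j * U + G) * decay_int (gam a b j) 1"
    if p: "p \<in> Strip" for p
  proof (rule order.trans[OF char_op_bound[OF p u g \<rho> U G]], assumption, assumption)
    have s: "\<bar>fst p - x_end m j\<bar> \<le> 1" using x_end_01[of j] p by (auto simp: Strip_def)
    have "- gam a b j * \<bar>fst p - x_end m j\<bar> \<le> \<bar>gam a b j\<bar> * 1"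
      using s by (intro mult_mono) auto
    then show "exp (- gam a b j * \<bar>fst p - x_end m j\<bar>) * \<rho> +
        (bet a b j * U + G) * decay_int (gam a b j) \<bar>fst p - x_end m j\<bar>
        \<le> exp \<bar>gam a b j\<bar> * \<rho> + (bet a b j * U + G) * decay_int (gam a b j) 1"
      using \<open>0 \<le> \<rho>\<close> \<open>0 \<le> U\<close> \<open>0 \<le> G\<close> bet_nonneg[of j] s
      by (intro add_mono mult_right_mono mult_left_mono decay_int_mono) auto
  qed
  ultimately show "(\<lambda>p. char_op r u g p $ j) \<in> BC Strip" by (intro BC_I) auto
qed

end

section \<open>Weighted contractions\<close>

lemma BC_norm_scaleR_le:
  fixes u :: "'a::topological_space \<Rightarrow> real ^ 'n"
  assumes "u \<in> BC S" "S \<noteq> {}"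
  shows "BC_norm S (\<lambda>p. c *\<^sub>R u p) \<le> \<bar>c\<bar> * BC_norm S u"
  by (rule BC_norm_least[OF assms(2)])
     (simp add: abs_mult mult_left_mono BC_norm_upper[OF assms(1)])

lemma bcontfun_BC: "apply_bcontfun u \<in> BC S"
  for u :: "'a::topological_space \<Rightarrow>\<^sub>C 'b::real_normed_vector"
  by (rule BC_I[where B="norm u"]) (auto intro: norm_bounded)

lemma Bcontfun_inverse_BC: "f \<in> BC UNIV \<Longrightarrow> apply_bcontfun (Bcontfun f) = f"
  by (rule Bcontfun_inverse) (simp add: BC_def bcontfun_def)

lemma BC_norm_le_norm:
  fixes u :: "'a::topological_space \<Rightarrow>\<^sub>C (real ^ 'n)"
  shows "BC_norm UNIV (apply_bcontfun u) \<le> norm u"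
  by (rule BC_norm_least) (auto intro: order.trans[OF component_le_norm_cart norm_bounded])

lemma norm_le_BC_norm:
  fixes u :: "'a::topological_space \<Rightarrow>\<^sub>C (real ^ 'n)"
  shows "norm u \<le> real CARD('n) * BC_norm UNIV (apply_bcontfun u)"
proof (rule norm_bound)
  fix x
  have "norm (apply_bcontfun u x) \<le> (\<Sum>j\<in>UNIV. \<bar>apply_bcontfun u x $ j\<bar>)" by (rule norm_le_l1_cart)
  also have "\<dots> \<le> real CARD('n) * BC_norm UNIV (apply_bcontfun u)"
    by (rule sum_bounded_above) (rule BC_norm_upper[OF bcontfun_BC UNIV_I])
  finally show "norm (apply_bcontfun u x) \<le> real CARD('n) * BC_norm UNIV (apply_bcontfun u)" .
qed

text \<open>\<open>R_norm_comp\<close> is a supremum of suprema of reals. Both are genuine because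
  the library operator norm of \<open>R\<close>, times \<open>CARD('n)\<close> from the comparison
  of the two norms, bounds all the values.\<close>

lemma R_norm_comp_upper:
  fixes R :: "'n::finite BC_op"
  assumes "BC_norm UNIV (apply_bcontfun u) = 1"
  shows "\<bar>apply_bcontfun (blinfun_apply R u) t $ j\<bar> \<le> R_norm_comp R j"
proof -
  have bd: "\<bar>apply_bcontfun (blinfun_apply R w) s $ j\<bar> \<le> norm R * real CARD('n)"
    if "BC_norm UNIV (apply_bcontfun w) = 1" for w s
  proof -
    have "\<bar>apply_bcontfun (blinfun_apply R w) s $ j\<bar> \<le> norm (blinfun_apply R w)"
      by (rule order.trans[OF component_le_norm_cart norm_bounded])
    also have "\<dots> \<le> norm R * norm w" by (rule norm_blinfun)
    also have "\<dots> \<le> norm R * real CARD('n)"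
      using norm_le_BC_norm[of w] that by (intro mult_left_mono) auto
    finally show ?thesis .
  qed
  have "\<bar>apply_bcontfun (blinfun_apply R u) t $ j\<bar> \<le> (SUP t. \<bar>apply_bcontfun (blinfun_apply R u) t $ j\<bar>)"
    using bd[OF assms] by (intro cSUP_upper bdd_aboveI2[where M="norm R * real CARD('n)"]) auto
  also have "\<dots> \<le> R_norm_comp R j"
    unfolding R_norm_comp_def
    by (intro cSUP_upper bdd_aboveI2[where M="norm R * real CARD('n)"] cSUP_least) (use assms bd in auto)
  finally show ?thesis .
qed

text \<open>The constant function with all components 1 shows that the unit sphere is nonempty,
  without which the supremum would be unspecified.\<close>

lemma R_norm_comp_nonneg: "0 \<le> R_norm_comp R j" for R :: "'n::finite BC_op"
proof -
  let ?e = "const_bcontfun (\<chi> i. 1) :: real \<Rightarrow>\<^sub>C (real ^ 'n)"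
  have "BC_norm UNIV (apply_bcontfun ?e) = 1"
  proof (rule antisym)
    show "1 \<le> BC_norm UNIV (apply_bcontfun ?e)"
      using BC_norm_upper[OF bcontfun_BC UNIV_I, of ?e 0 j] by (simp add: const_bcontfun.rep_eq)
  qed (auto intro!: BC_norm_least simp: const_bcontfun.rep_eq)
  from order.trans[OF abs_ge_zero R_norm_comp_upper[OF this]] show ?thesis .
qed

lemma R_norm_comp_bound:
  fixes R :: "'n::finite BC_op"
  shows "\<bar>apply_bcontfun (blinfun_apply R u) t $ j\<bar> \<le> R_norm_comp R j * BC_norm UNIV (apply_bcontfun u)"
proof (cases "BC_norm UNIV (apply_bcontfun u) = 0")
  case True
  then have "u = 0" using norm_le_BC_norm[of u] by simp
  then show ?thesis using True by (simp add: blinfun.zero_right)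
next
  case False
  let ?B = "BC_norm UNIV (apply_bcontfun u)" and ?w = "inverse (BC_norm UNIV (apply_bcontfun u)) *\<^sub>R u"
  have B: "?B > 0" using False BC_norm_nonneg[OF bcontfun_BC, of UNIV u] by simp
  have "BC_norm UNIV (apply_bcontfun ?w) = 1"
  proof (rule antisym)
    show "BC_norm UNIV (apply_bcontfun ?w) \<le> 1"
      using BC_norm_scaleR_le[OF bcontfun_BC, of UNIV "inverse ?B" u] B by (simp add: scaleR_bcontfun.rep_eq)
    \<comment> \<open>Scaling is available only as an inequality; scaling \<open>?w\<close> back to
      \<open>u\<close> gives the converse, hence norm exactly 1.\<close>
    have "?B \<le> ?B * BC_norm UNIV (apply_bcontfun ?w)"
      using BC_norm_scaleR_le[OF bcontfun_BC, of UNIV ?B ?w] B by (simp add: scaleR_bcontfun.rep_eq)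
    then show "1 \<le> BC_norm UNIV (apply_bcontfun ?w)" using B by simp
  qed
  from R_norm_comp_upper[OF this, of R t j]
  have "inverse ?B * \<bar>apply_bcontfun (blinfun_apply R u) t $ j\<bar> \<le> R_norm_comp R j"
    using B by (simp add: blinfun.scaleR_right scaleR_bcontfun.rep_eq abs_mult)
  then show ?thesis using B by (simp add: field_simps)
qed

text \<open>A contraction in N need not contract in the norm, but its k-th power has Lipschitz
  constant at most D \<theta>^k C there, which is below 1 for large k. F maps the unique fixed point
  of that power to a fixed point of it, hence to itself.\<close>

lemma weighted_contraction_fixpoint:
  fixes F :: "'a::{real_normed_vector, complete_space} \<Rightarrow> 'a" and N :: "'a \<Rightarrow> real"
  assumes N_le: "\<And>x. N x \<le> C * norm x" and le_N: "\<And>x. norm x \<le> D * N x" and "C > 0" "D > 0"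
    and contr: "\<And>x y. N (F x - F y) \<le> \<theta> * N (x - y)" and \<theta>: "0 \<le> \<theta>" "\<theta> < 1"
  shows "\<exists>x. F x = x"
proof -
  have iter: "N ((F ^^ k) x - (F ^^ k) y) \<le> \<theta> ^ k * N (x - y)" for k x y
  proof (induction k)
    case (Suc k)
    have "N ((F ^^ Suc k) x - (F ^^ Suc k) y) \<le> \<theta> * N ((F ^^ k) x - (F ^^ k) y)" by (simp add: contr)
    also have "\<dots> \<le> \<theta> * (\<theta> ^ k * N (x - y))" by (intro mult_left_mono Suc \<theta>)
    finally show ?case by (simp add: mult.assoc)
  qed simp
  obtain k where k: "\<theta> ^ k < 1 / (D * C)"
    using real_arch_pow_inv[OF _ \<theta>(2), of "1 / (D * C)"] \<open>C > 0\<close> \<open>D > 0\<close> by auto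
  have "\<exists>!x. (F ^^ k) x = x"
  proof (rule banach_fix_type)
    show "\<forall>x y. dist ((F ^^ k) x) ((F ^^ k) y) \<le> (D * \<theta> ^ k * C) * dist x y"
    proof (intro allI)
      fix x y
      have "norm ((F ^^ k) x - (F ^^ k) y) \<le> D * N ((F ^^ k) x - (F ^^ k) y)" by (rule le_N)
      also have "\<dots> \<le> D * (\<theta> ^ k * (C * norm (x - y)))"
        using \<open>D > 0\<close> \<theta>
        by (intro mult_left_mono order.trans[OF iter] N_le zero_le_power) auto
      finally show "dist ((F ^^ k) x) ((F ^^ k) y) \<le> (D * \<theta> ^ k * C) * dist x y"
        by (simp add: dist_norm mult_ac)
    qed
    show "0 \<le> D * \<theta> ^ k * C" using \<open>D > 0\<close> \<open>C > 0\<close> \<theta> by simp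
    show "D * \<theta> ^ k * C < 1" using k \<open>D > 0\<close> \<open>C > 0\<close> by (simp add: field_simps)
  qed
  then obtain x where x: "(F ^^ k) x = x" and uniq: "\<And>y. (F ^^ k) y = y \<Longrightarrow> y = x" by blast
  have "(F ^^ k) (F x) = F x" by (metis funpow_swap1 x)
  then show ?thesis using uniq by blast
qed

section \<open>Choice of the weights\<close>

text \<open>A statement about bare numbers, with (B1) and (B2) split by the sign of
  \<open>\<gamma> j\<close> instead of that of inf b_jj. The first inequality is needed at every
  distance s because u is measured on the whole strip.\<close>

lemma weights_exist:
  fixes \<gamma> \<beta> \<rho> :: "'n::finite \<Rightarrow> real"
  assumes \<beta>: "\<And>j. 0 \<le> \<beta> j" and \<rho>: "\<And>j. 0 \<le> \<rho> j"
    and cond: "(\<forall>j. (\<gamma> j > 0 \<longrightarrow> \<rho> j + \<beta> j / \<gamma> j * (1 - exp (- \<gamma> j)) < 1) \<and>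
        (\<gamma> j < 0 \<longrightarrow> exp (- \<gamma> j) * \<rho> j + \<beta> j / \<gamma> j * (1 - exp (- \<gamma> j)) < 1) \<and>
        (\<gamma> j = 0 \<longrightarrow> \<rho> j + \<beta> j < 1)) \<or>
      (\<forall>j. \<gamma> j > 0 \<and> exp (- \<gamma> j) * \<rho> j < 1 \<and>
        (1 + Max (range \<rho>) * inverse (1 - Max (range (\<lambda>i. exp (- \<gamma> i) * \<rho> i)))) * (\<beta> j / \<gamma> j) * (1 - exp (- \<gamma> j)) < 1)"
  obtains \<mu> \<kappa> \<theta> :: real where "\<mu> > 0" "\<kappa> > 0" "0 \<le> \<theta>" "\<theta> < 1"
    "\<And>j s. s \<in> {0..1} \<Longrightarrow> exp (- \<gamma> j * s) * \<rho> j * \<kappa> + \<beta> j * decay_int (\<gamma> j) s * \<mu> \<le> \<theta> * \<mu>"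
    "\<And>j. exp (- \<gamma> j) * \<rho> j * \<kappa> + \<beta> j * decay_int (\<gamma> j) 1 * \<mu> \<le> \<theta> * \<kappa>"
  using cond
proof (elim disjE)
  assume B1: "\<forall>j. (\<gamma> j > 0 \<longrightarrow> \<rho> j + \<beta> j / \<gamma> j * (1 - exp (- \<gamma> j)) < 1) \<and>
        (\<gamma> j < 0 \<longrightarrow> exp (- \<gamma> j) * \<rho> j + \<beta> j / \<gamma> j * (1 - exp (- \<gamma> j)) < 1) \<and>
        (\<gamma> j = 0 \<longrightarrow> \<rho> j + \<beta> j < 1)"
  \<comment> \<open>\<open>max 1 (exp (- \<gamma> j))\<close> is the largest value of exp(-\<gamma>
    s) for s in \<open>{0..1}\<close>; with it the three cases of (B1) all say
    \<open>\<tau> j < 1\<close>.\<close>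
  define \<tau> where "\<tau> j = max 1 (exp (- \<gamma> j)) * \<rho> j + \<beta> j * decay_int (\<gamma> j) 1" for j
  have \<tau>0: "0 \<le> \<tau> j" for j
    unfolding \<tau>_def using \<beta>[of j] \<rho>[of j] by (intro add_nonneg_nonneg mult_nonneg_nonneg decay_int_nonneg) auto
  have \<tau>1: "\<tau> j < 1" for j
    using B1[rule_format, of j]
    by (cases "\<gamma> j" "0::real" rule: linorder_cases) (auto simp: \<tau>_def decay_int_def max_def)
  have \<theta>: "\<tau> j \<le> Max (range \<tau>)" for j by (rule Max_ge) auto
  have main: "exp (- \<gamma> j * s) * \<rho> j * 1 + \<beta> j * decay_int (\<gamma> j) s * 1 \<le> Max (range \<tau>) * 1"
    if s: "s \<in> {0..1}" for j s
  proof -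
    have "exp (- \<gamma> j * s) \<le> max 1 (exp (- \<gamma> j))"
    proof (cases "\<gamma> j \<ge> 0")
      case False
      then have "- \<gamma> j * s \<le> - \<gamma> j * 1" using s by (intro mult_left_mono) auto
      then show ?thesis by (simp add: le_max_iff_disj)
    qed (use s in \<open>simp add: le_max_iff_disj\<close>)
    then have "exp (- \<gamma> j * s) * \<rho> j * 1 + \<beta> j * decay_int (\<gamma> j) s * 1 \<le> \<tau> j"
      unfolding \<tau>_def mult_1_right using s \<beta>[of j] \<rho>[of j]
      by (intro add_mono mult_right_mono mult_left_mono decay_int_mono) auto
    also have "\<tau> j \<le> Max (range \<tau>)" by (rule \<theta>)
    finally show ?thesis unfolding mult_1_right .
  qed
  show thesis
  proof (rule that)
    show "exp (- \<gamma> j) * \<rho> j * 1 + \<beta> j * decay_int (\<gamma> j) 1 * 1 \<le> Max (range \<tau>) * 1" for j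
      using main[of 1 j] by simp
    show "Max (range \<tau>) < 1" using \<tau>1 by (subst Max_less_iff) auto
    show "0 \<le> Max (range \<tau>)" using \<tau>0 \<theta> order.trans by blast
  qed (use main in auto)
next
  \<comment> \<open>(B2) says exactly that the nonnegative matrix with rows \<open>(\<delta>, P)\<close> and \<open>(\<delta>, r)\<close> has spectral
    radius below 1; \<open>(\<mu>, 1)\<close> is a positive vector that it shrinks.\<close>
  assume B2: "\<forall>j. \<gamma> j > 0 \<and> exp (- \<gamma> j) * \<rho> j < 1 \<and>
        (1 + Max (range \<rho>) * inverse (1 - Max (range (\<lambda>i. exp (- \<gamma> i) * \<rho> i)))) * (\<beta> j / \<gamma> j) * (1 - exp (- \<gamma> j)) < 1"
  define P where "P = Max (range \<rho>)"
  define r where "r = Max (range (\<lambda>i. exp (- \<gamma> i) * \<rho> i))"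
  define \<delta> where "\<delta> = Max (range (\<lambda>j. \<beta> j * decay_int (\<gamma> j) 1))"
  have P: "\<rho> j \<le> P" and r: "exp (- \<gamma> j) * \<rho> j \<le> r" and \<delta>: "\<beta> j * decay_int (\<gamma> j) 1 \<le> \<delta>" for j
    by (auto simp: P_def r_def \<delta>_def)
  have P0: "0 \<le> P" using order.trans[OF \<rho> P] .
  have r1: "r < 1" unfolding r_def using B2 by (subst Max_less_iff) auto
  have r0: "0 \<le> r" by (rule order.trans[OF _ r[of undefined]]) (simp add: \<rho>)
  have \<delta>0: "0 \<le> \<delta>" by (rule order.trans[OF _ \<delta>[of undefined]]) (simp add: \<beta> decay_int_nonneg)
  \<comment> \<open>At an index where the maximum \<delta> is attained, (B2) becomes an inequality
    between \<delta>, P and r alone.\<close>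
  have "\<delta> \<in> range (\<lambda>j. \<beta> j * decay_int (\<gamma> j) 1)" unfolding \<delta>_def by (rule Max_in) auto
  then obtain j where j: "\<delta> = \<beta> j * decay_int (\<gamma> j) 1" by blast
  have "(1 + P * inverse (1 - r)) * (\<beta> j / \<gamma> j) * (1 - exp (- \<gamma> j)) < 1" and "\<gamma> j > 0"
    using B2 unfolding P_def r_def by blast+
  then have "(1 + P / (1 - r)) * \<delta> < 1"
    by (simp add: j decay_int_def divide_inverse mult_ac)
  then have *: "\<delta> * (1 - r) + P * \<delta> < 1 - r"
    using r1 by (simp add: field_simps)
  have \<delta>1: "\<delta> < 1"
  proof (rule ccontr)
    assume "\<not> \<delta> < 1"
    then have "1 * (1 - r) \<le> \<delta> * (1 - r)" using r1 by (intro mult_right_mono) auto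
    moreover have "0 \<le> P * \<delta>" using P0 \<delta>0 by simp
    ultimately have "1 * (1 - r) + 0 \<le> \<delta> * (1 - r) + P * \<delta>" by (rule add_mono)
    then show False using * by simp
  qed
  \<comment> \<open>The weight must satisfy \<mu> > P / (1 - \<delta>) for the first row and
    \<delta> \<mu> < 1 - r for the second. \<sigma> is the slack in the second at \<mu> = P / (1 -
    \<delta>), positive by (B2). Raising \<mu> by \<eta> uses up \<delta> \<eta> of it; the
    denominator \<delta> + 1 keeps this below \<sigma> also when \<delta> = 0.\<close>
  define \<sigma> where "\<sigma> = (1 - r) - \<delta> * P / (1 - \<delta>)"
  have "\<sigma> > 0" using * \<delta>1 by (simp add: \<sigma>_def field_simps)
  define \<eta> where "\<eta> = \<sigma> / (\<delta> + 1)"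
  define \<mu> where "\<mu> = P / (1 - \<delta>) + \<eta>"
  have \<eta>: "\<eta> > 0" using \<open>\<sigma> > 0\<close> \<delta>0 by (simp add: \<eta>_def)
  have \<mu>: "\<mu> > 0" using \<eta> P0 \<delta>1 by (simp add: \<mu>_def add_nonneg_pos)
  have 1: "P + \<delta> * \<mu> < \<mu>"
  proof -
    have "(1 - \<delta>) * \<mu> = P + (1 - \<delta>) * \<eta>" using \<delta>1 by (simp add: \<mu>_def field_simps)
    moreover have "(1 - \<delta>) * \<eta> > 0" using \<delta>1 \<eta> by simp
    ultimately show ?thesis by (simp add: algebra_simps)
  qed
  have 2: "r + \<delta> * \<mu> < 1"
  proof -
    have "\<delta> * \<eta> < \<sigma>" using \<delta>0 \<open>\<sigma> > 0\<close> by (simp add: \<eta>_def field_simps)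
    moreover have "\<delta> * \<mu> = \<delta> * P / (1 - \<delta>) + \<delta> * \<eta>" by (simp add: \<mu>_def algebra_simps)
    ultimately show ?thesis by (simp add: \<sigma>_def)
  qed
  define \<theta> where "\<theta> = max ((P + \<delta> * \<mu>) / \<mu>) (r + \<delta> * \<mu>)"
  have \<theta>: "P + \<delta> * \<mu> \<le> \<theta> * \<mu>" "r + \<delta> * \<mu> \<le> \<theta>"
    using \<mu> by (auto simp: \<theta>_def pos_divide_le_eq[symmetric])
  show thesis
  proof (rule that[of \<mu> 1 \<theta>])
    show "0 \<le> \<theta>" using r0 \<delta>0 \<mu> by (simp add: \<theta>_def le_max_iff_disj)
    show "\<theta> < 1" using 1 2 \<mu> by (simp add: \<theta>_def)
    show "exp (- \<gamma> j * s) * \<rho> j * 1 + \<beta> j * decay_int (\<gamma> j) s * \<mu> \<le> \<theta> * \<mu>" if s: "s \<in> {0..1}" for j s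
    proof -
      have "0 < \<gamma> j" using B2 by blast
      then have "exp (- \<gamma> j * s) \<le> 1" using s by simp
      then have "exp (- \<gamma> j * s) * \<rho> j \<le> 1 * P" by (intro mult_mono P \<rho>) auto
      moreover have "\<beta> j * decay_int (\<gamma> j) s \<le> \<beta> j * decay_int (\<gamma> j) 1"
        using s by (intro mult_left_mono decay_int_mono \<beta>) auto
      then have "\<beta> j * decay_int (\<gamma> j) s * \<mu> \<le> \<delta> * \<mu>"
        using \<delta>[of j] \<mu> by (intro mult_right_mono) auto
      ultimately show ?thesis using \<theta>(1) by simp
    qed
    show "exp (- \<gamma> j) * \<rho> j * 1 + \<beta> j * decay_int (\<gamma> j) 1 * \<mu> \<le> \<theta> * 1" for j
      using add_mono[OF r[of j] mult_right_mono[OF \<delta>[of j] less_imp_le[OF \<mu>]]] \<theta>(2) by simp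
  qed (use \<mu> in auto)
qed

section \<open>The fixed point problem\<close>

lemma z_trace_BC:
  fixes u :: "('n::{finite,linorder}) vec_field"
  assumes "u \<in> BC Strip" shows "z_trace m u \<in> BC UNIV"
  unfolding BC_vec_iff
proof
  fix j :: 'n
  have edge: "(\<lambda>t. u (e, t) $ j) \<in> BC UNIV" if "e \<in> {0, 1}" for e
  proof -
    obtain B where B: "\<And>p. p \<in> Strip \<Longrightarrow> norm (u p $ j) \<le> B"
      using assms BC_bound[of "\<lambda>p. u p $ j" Strip] unfolding BC_vec_iff by metis
    have "continuous_on Strip (\<lambda>p. u p $ j)" using assms by (intro BC_continuous) (auto simp: BC_vec_iff)
    then have "continuous_on UNIV (\<lambda>t. u (e, t) $ j)"
      by (rule continuous_on_compose2) (use that in \<open>auto simp: Strip_def intro!: continuous_intros\<close>)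
    then show ?thesis by (rule BC_I[where B=B]) (rule B, use that in \<open>auto simp: Strip_def\<close>)
  qed
  show "(\<lambda>t. z_trace m u t $ j) \<in> BC UNIV"
    using edge[of 0] edge[of 1] by (cases "idx j \<le> m") (simp_all add: z_trace_def)
qed

definition trace_bcf :: "nat \<Rightarrow> ('n::{finite,linorder}) vec_field \<Rightarrow> real \<Rightarrow>\<^sub>C (real, 'n) vec" where
  "trace_bcf m u = Bcontfun (z_trace m u)"

lemma trace_bcf_apply: "u \<in> BC Strip \<Longrightarrow> apply_bcontfun (trace_bcf m u) = z_trace m u"
  unfolding trace_bcf_def by (rule Bcontfun_inverse_BC[OF z_trace_BC])

lemma trace_bcf_diff:
  assumes "u \<in> BC Strip" "v \<in> BC Strip"
  shows "trace_bcf m (\<lambda>p. u p - v p) = trace_bcf m u - trace_bcf m v"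
  by (rule bcontfun_eqI)
     (simp add: trace_bcf_apply assms BC_diff minus_bcontfun.rep_eq z_trace_def vec_eq_iff)

lemma z_trace_cong: "(\<And>p. p \<in> Strip \<Longrightarrow> u p = v p) \<Longrightarrow> z_trace m u = z_trace m v"
  by (rule ext) (simp add: z_trace_def vec_eq_iff Strip_def)

section \<open>Sign of gamma_j and sign of inf b_jj\<close>

context hyperbolic_system
begin

lemma a_bound:
  obtains M where "M > 0" "\<And>p. p \<in> Strip \<Longrightarrow> \<bar>a p $ j\<bar> \<le> M"
  using BC_bound[OF BC_Lip_BC[OF a_Lip[of j]]] by (metis real_norm_def)

lemma inf_b_le:
  assumes "p \<in> Strip" shows "(INF p\<in>Strip. b p $ j $ j) \<le> b p $ j $ j"
proof -
  obtain B where B: "\<And>p. p \<in> Strip \<Longrightarrow> norm (b p $ j $ j) \<le> B"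
    using BC_bound[OF b_entry_BC[of j j]] by metis
  have "bdd_below ((\<lambda>p. b p $ j $ j) ` Strip)"
    by (rule bdd_belowI2[where m="- B"]) (use B in \<open>force simp: abs_le_iff\<close>)
  then show ?thesis using assms by (rule cINF_lower)
qed

lemma Strip_nonempty: "Strip \<noteq> {}"
  by (auto simp: Strip_def)

lemma le_gam:
  assumes "\<And>p. p \<in> Strip \<Longrightarrow> c * \<bar>a p $ j\<bar> \<le> b p $ j $ j" shows "c \<le> gam a b j"
  unfolding gam_def
  by (rule cINF_greatest[OF Strip_nonempty]) (use assms a_nz in \<open>simp add: pos_le_divide_eq\<close>)

text \<open>Positivity of an infimum is not a pointwise matter, so both bounds on the speed enter:
  gamma_j l is at most inf b_jj, and inf b_jj divided by an upper bound of |a_j| is at most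
  gamma_j.\<close>

lemma gam_pos_iff: "gam a b j > 0 \<longleftrightarrow> (INF p\<in>Strip. b p $ j $ j) > 0"
proof
  assume g: "gam a b j > 0"
  have "gam a b j * l \<le> (INF p\<in>Strip. b p $ j $ j)"
  proof (rule cINF_greatest[OF Strip_nonempty])
    fix p :: "real \<times> real" assume p: "p \<in> Strip"
    have "gam a b j * l \<le> gam a b j * \<bar>a p $ j\<bar>" using g a_away[OF p] by (intro mult_left_mono) auto
    also have "\<dots> \<le> b p $ j $ j" by (rule gam_le[OF p])
    finally show "gam a b j * l \<le> b p $ j $ j" .
  qed
  moreover have "gam a b j * l > 0" using g l_pos by simp
  ultimately show "(INF p\<in>Strip. b p $ j $ j) > 0" by linarith
next
  assume i: "(INF p\<in>Strip. b p $ j $ j) > 0" (is "?i > 0")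
  obtain M where M: "M > 0" "\<And>p. p \<in> Strip \<Longrightarrow> \<bar>a p $ j\<bar> \<le> M" using a_bound by metis
  have "?i / M \<le> gam a b j"
  proof (rule le_gam)
    fix p :: "real \<times> real" assume p: "p \<in> Strip"
    have "?i / M * \<bar>a p $ j\<bar> \<le> ?i / M * M" using i M p by (intro mult_left_mono) auto
    also have "\<dots> \<le> b p $ j $ j" using inf_b_le[OF p] M by simp
    finally show "?i / M * \<bar>a p $ j\<bar> \<le> b p $ j $ j" .
  qed
  moreover have "?i / M > 0" using i M by simp
  ultimately show "gam a b j > 0" by linarith
qed

text \<open>An infimum is nonnegative exactly if all values are, and division by |a_j| preserves
  that at each point.\<close>

lemma gam_neg_iff: "gam a b j < 0 \<longleftrightarrow> (INF p\<in>Strip. b p $ j $ j) < 0"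
proof -
  have "0 \<le> gam a b j \<longleftrightarrow> (\<forall>p\<in>Strip. 0 \<le> b p $ j $ j)"
  proof safe
    fix x t assume "0 \<le> gam a b j" and p: "(x, t) \<in> Strip"
    then show "0 \<le> b (x, t) $ j $ j" using gam_le[OF p, of j] by (meson abs_ge_zero mult_nonneg_nonneg order.trans)
  qed (auto intro!: le_gam)
  also have "\<dots> \<longleftrightarrow> 0 \<le> (INF p\<in>Strip. b p $ j $ j)"
    using inf_b_le[of _ j] by (auto intro!: cINF_greatest Strip_nonempty intro: order.trans)
  finally show ?thesis by linarith
qed

lemma weights:
  assumes "cond_B1 R a b \<or> cond_B2 R a b"
  obtains \<mu> \<kappa> \<theta> :: real where "\<mu> > 0" "\<kappa> > 0" "0 \<le> \<theta>" "\<theta> < 1"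
    "\<And>j s. s \<in> {0..1} \<Longrightarrow> exp (- gam a b j * s) * R_norm_comp R j * \<kappa> + bet a b j * decay_int (gam a b j) s * \<mu> \<le> \<theta> * \<mu>"
    "\<And>j. exp (- gam a b j) * R_norm_comp R j * \<kappa> + bet a b j * decay_int (gam a b j) 1 * \<mu> \<le> \<theta> * \<kappa>"
proof (rule weights_exist[of "bet a b" "R_norm_comp R" "gam a b"])
  have zero: "gam a b j = 0 \<longleftrightarrow> (INF p\<in>Strip. b p $ j $ j) = 0" for j
    using gam_pos_iff[of j] gam_neg_iff[of j] by linarith
  show "(\<forall>j. (gam a b j > 0 \<longrightarrow> R_norm_comp R j + bet a b j / gam a b j * (1 - exp (- gam a b j)) < 1) \<and>
        (gam a b j < 0 \<longrightarrow> exp (- gam a b j) * R_norm_comp R j + bet a b j / gam a b j * (1 - exp (- gam a b j)) < 1) \<and>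
        (gam a b j = 0 \<longrightarrow> R_norm_comp R j + bet a b j < 1)) \<or>
      (\<forall>j. gam a b j > 0 \<and> exp (- gam a b j) * R_norm_comp R j < 1 \<and>
        (1 + Max (range (R_norm_comp R)) * inverse (1 - Max (range (\<lambda>i. exp (- gam a b i) * R_norm_comp R i))))
          * (bet a b j / gam a b j) * (1 - exp (- gam a b j)) < 1)"
    using assms unfolding cond_B1_def cond_B2_def R_norm_def gam_pos_iff gam_neg_iff zero .
qed (auto intro: bet_nonneg R_norm_comp_nonneg that)

end

text \<open>\<open>\<mu>\<close> weighs the supremum norm of \<open>u\<close>, and \<open>\<kappa>\<close> that of its outgoing boundary trace \<open>z\<close>.\<close>

locale hyperbolic_problem = hyperbolic_system m a b l
  for m and a :: "('n::{finite,linorder}) vec_field" and b l +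
  fixes R :: "'n BC_op" and \<mu> \<kappa> \<theta> :: real
  assumes \<mu>: "\<mu> > 0" and \<kappa>: "\<kappa> > 0" and \<theta>: "0 \<le> \<theta>" "\<theta> < 1"
    and weight_u: "\<And>j s. s \<in> {0..1} \<Longrightarrow> exp (- gam a b j * s) * R_norm_comp R j * \<kappa>
      + bet a b j * decay_int (gam a b j) s * \<mu> \<le> \<theta> * \<mu>"
    and weight_z: "\<And>j. exp (- gam a b j) * R_norm_comp R j * \<kappa>
      + bet a b j * decay_int (gam a b j) 1 * \<mu> \<le> \<theta> * \<kappa>"
begin

section \<open>Contraction, a priori estimate and fixed point\<close>

definition \<Phi> :: "'n vec_field \<Rightarrow> (real \<Rightarrow>\<^sub>C (real, 'n) vec) \<Rightarrow> 'n vec_field \<Rightarrow> 'n vec_field" where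
  "\<Phi> g h u = char_op (\<lambda>t. apply_bcontfun (blinfun_apply R (trace_bcf m u)) t + apply_bcontfun h t) u g"

lemma \<Phi>_BC:
  assumes "u \<in> BC Strip" "g \<in> BC Strip" shows "\<Phi> g h u \<in> BC Strip"
  unfolding \<Phi>_def by (intro char_op_BC assms BC_add bcontfun_BC)

text \<open>\<Phi> is linear in (g, h, u) jointly, so a difference of two solutions solves the
  problem with the difference of the data, and differences of images under a common g and h are
  governed by zero data.\<close>

lemma \<Phi>_diff:
  assumes "u \<in> BC Strip" "v \<in> BC Strip" "g \<in> BC Strip" "g' \<in> BC Strip" "p \<in> Strip"
  shows "\<Phi> (\<lambda>p. g p - g' p) (h - h') (\<lambda>p. u p - v p) p = \<Phi> g h u p - \<Phi> g' h' v p"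
proof -
  have "(\<lambda>t. apply_bcontfun (blinfun_apply R (trace_bcf m (\<lambda>p. u p - v p))) t + apply_bcontfun (h - h') t) =
      (\<lambda>t. (apply_bcontfun (blinfun_apply R (trace_bcf m u)) t + apply_bcontfun h t)
        - (apply_bcontfun (blinfun_apply R (trace_bcf m v)) t + apply_bcontfun h' t))"
    by (rule ext) (simp add: trace_bcf_diff assms blinfun.diff_right minus_bcontfun.rep_eq)
  then show ?thesis unfolding \<Phi>_def by (simp add: char_op_diff assms)
qed

text \<open>The hypotheses on u and its trace say that N bounds the weighted norm of u. N, H and G
  are free parameters so that the same estimate yields the contraction (H = G = 0) and the a priori
  bound.\<close>

lemma \<Phi>_bounds:
  obtains C where "C > 0"
    "\<And>u g h N H G. \<lbrakk>u \<in> BC Strip; g \<in> BC Strip; \<And>p k. p \<in> Strip \<Longrightarrow> \<bar>u p $ k\<bar> \<le> \<mu> * N;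
      \<And>t k. \<bar>z_trace m u t $ k\<bar> \<le> \<kappa> * N; \<And>t k. \<bar>apply_bcontfun h t $ k\<bar> \<le> H;
      \<And>p k. p \<in> Strip \<Longrightarrow> \<bar>g p $ k / a p $ k\<bar> \<le> G\<rbrakk> \<Longrightarrow>
      (\<forall>p\<in>Strip. \<forall>j. \<bar>\<Phi> g h u p $ j\<bar> \<le> \<theta> * N * \<mu> + C * (H + G)) \<and>
      (\<forall>t j. \<bar>z_trace m (\<Phi> g h u) t $ j\<bar> \<le> \<theta> * N * \<kappa> + C * (H + G))"
proof -
  \<comment> \<open>One constant for all components: exp |gamma_j| bounds exp(-gamma_j s), and
    \<open>decay_int\<close> at 1 bounds its values, for all s in \<open>{0..1}\<close>.\<close>
  define C where "C = 1 + (\<Sum>j\<in>UNIV. exp \<bar>gam a b j\<bar> + decay_int (gam a b j) 1)"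
  have pos: "0 \<le> decay_int (gam a b j) 1" for j by (rule decay_int_nonneg) simp
  have C: "exp \<bar>gam a b j\<bar> + decay_int (gam a b j) 1 \<le> C" for j
    using member_le_sum[of j UNIV "\<lambda>j. exp \<bar>gam a b j\<bar> + decay_int (gam a b j) 1"] pos
    unfolding C_def by (simp add: add_nonneg_nonneg)
  have "C > 0" unfolding C_def by (intro add_pos_nonneg sum_nonneg add_nonneg_nonneg pos) auto
  moreover have "(\<forall>p\<in>Strip. \<forall>j. \<bar>\<Phi> g h u p $ j\<bar> \<le> \<theta> * N * \<mu> + C * (H + G)) \<and>
      (\<forall>t j. \<bar>z_trace m (\<Phi> g h u) t $ j\<bar> \<le> \<theta> * N * \<kappa> + C * (H + G))"
    if u: "u \<in> BC Strip" and g: "g \<in> BC Strip" and U: "\<And>p k. p \<in> Strip \<Longrightarrow> \<bar>u p $ k\<bar> \<le> \<mu> * N"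
      and Z: "\<And>t k. \<bar>z_trace m u t $ k\<bar> \<le> \<kappa> * N" and H: "\<And>t k. \<bar>apply_bcontfun h t $ k\<bar> \<le> H"
      and G: "\<And>p k. p \<in> Strip \<Longrightarrow> \<bar>g p $ k / a p $ k\<bar> \<le> G" for u g h N H G
  proof -
    have "0 \<le> \<kappa> * N" by (rule order.trans[OF abs_ge_zero Z[of 0 undefined]])
    then have N: "0 \<le> N" using \<kappa> by (simp add: zero_le_mult_iff)
    have H0: "0 \<le> H" by (rule order.trans[OF abs_ge_zero H[of 0 undefined]])
    have G0: "0 \<le> G" by (rule order.trans[OF abs_ge_zero G[of "(0, 0)" undefined]]) (simp add: Strip_def)
    have r: "\<bar>(apply_bcontfun (blinfun_apply R (trace_bcf m u)) t + apply_bcontfun h t) $ j\<bar>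
        \<le> R_norm_comp R j * (\<kappa> * N) + H" for t j
    proof -
      have "BC_norm UNIV (apply_bcontfun (trace_bcf m u)) \<le> \<kappa> * N"
        by (rule BC_norm_least) (auto simp: trace_bcf_apply[OF u] Z)
      then have "\<bar>apply_bcontfun (blinfun_apply R (trace_bcf m u)) t $ j\<bar> \<le> R_norm_comp R j * (\<kappa> * N)"
        by (intro order.trans[OF R_norm_comp_bound] mult_left_mono R_norm_comp_nonneg)
      then show ?thesis using H[of t j] by simp
    qed
    have main: "\<bar>\<Phi> g h u p $ j\<bar> \<le> N * (exp (- gam a b j * s) * R_norm_comp R j * \<kappa>
        + bet a b j * decay_int (gam a b j) s * \<mu>) + C * (H + G)"
      if p: "p \<in> Strip" and s: "s = \<bar>fst p - x_end m j\<bar>" for p j s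
    proof -
      have s01: "0 \<le> s" "s \<le> 1" using x_end_01[of j] p s by (auto simp: Strip_def)
      have "\<bar>\<Phi> g h u p $ j\<bar> \<le> exp (- gam a b j * s) * (R_norm_comp R j * (\<kappa> * N) + H)
          + (bet a b j * (\<mu> * N) + G) * decay_int (gam a b j) s"
        unfolding \<Phi>_def s by (rule char_op_bound[OF p u g r U G])
      also have "\<dots> = N * (exp (- gam a b j * s) * R_norm_comp R j * \<kappa>
          + bet a b j * decay_int (gam a b j) s * \<mu>) + (exp (- gam a b j * s) * H + decay_int (gam a b j) s * G)"
        by (simp add: algebra_simps)
      also have "exp (- gam a b j * s) * H + decay_int (gam a b j) s * G \<le> C * H + C * G"
      proof (intro add_mono mult_right_mono H0 G0)
        have "- gam a b j * s \<le> \<bar>gam a b j\<bar> * 1" using s01 by (intro mult_mono) auto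
        then show "exp (- gam a b j * s) \<le> C" using C[of j] pos[of j] exp_le_cancel_iff[of "- gam a b j * s" "\<bar>gam a b j\<bar>"] by linarith
        show "decay_int (gam a b j) s \<le> C"
          using decay_int_mono[OF s01(2), of "gam a b j"] C[of j] exp_gt_zero[of "\<bar>gam a b j\<bar>"] by linarith
      qed
      finally show ?thesis by (simp add: distrib_left)
    qed
    have "\<bar>\<Phi> g h u p $ j\<bar> \<le> \<theta> * N * \<mu> + C * (H + G)" if p: "p \<in> Strip" for p j
    proof (rule order.trans[OF main[OF p refl]])
      have "\<bar>fst p - x_end m j\<bar> \<in> {0..1}" using x_end_01[of j] p by (auto simp: Strip_def)
      from mult_left_mono[OF weight_u[OF this, of j] N]
      show "N * (exp (- gam a b j * \<bar>fst p - x_end m j\<bar>) * R_norm_comp R j * \<kappa>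
        + bet a b j * decay_int (gam a b j) \<bar>fst p - x_end m j\<bar> * \<mu>) + C * (H + G)
        \<le> \<theta> * N * \<mu> + C * (H + G)" by (simp add: mult_ac)
    qed
    moreover have "\<bar>z_trace m (\<Phi> g h u) t $ j\<bar> \<le> \<theta> * N * \<kappa> + C * (H + G)" for t j
    proof -
      \<comment> \<open>The outgoing boundary point of component j, at distance exactly 1 from the
        incoming one, so that \<open>weight_z\<close> applies.\<close>
      let ?p = "(1 - x_end m j, t)"
      have "z_trace m (\<Phi> g h u) t $ j = \<Phi> g h u ?p $ j" by (simp add: z_trace_def x_end_def)
      moreover have "?p \<in> Strip" "1 = \<bar>fst ?p - x_end m j\<bar>" by (auto simp: Strip_def x_end_def)
      note main[OF this]
      moreover have "N * (exp (- gam a b j * 1) * R_norm_comp R j * \<kappa> + bet a b j * decay_int (gam a b j) 1 * \<mu>)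
          \<le> \<theta> * N * \<kappa>"
        using mult_left_mono[OF weight_z[of j] N] by (simp add: mult_ac)
      ultimately show ?thesis by linarith
    qed
    ultimately show ?thesis by blast
  qed
  ultimately show ?thesis by (rule that)
qed

text \<open>For a fixed point the estimate reads N \<le> \<theta> N + data with N the weighted norm
  of u itself; since N is finite and \<theta> < 1, the first term is absorbed on the left.\<close>

lemma \<Phi>_apriori:
  obtains C where "C > 0"
    "\<And>u g h H G p k. \<lbrakk>u \<in> BC Strip; g \<in> BC Strip; \<And>p. p \<in> Strip \<Longrightarrow> u p = \<Phi> g h u p;
      \<And>t k. \<bar>apply_bcontfun h t $ k\<bar> \<le> H; \<And>p k. p \<in> Strip \<Longrightarrow> \<bar>g p $ k / a p $ k\<bar> \<le> G; p \<in> Strip\<rbrakk> \<Longrightarrow>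
      \<bar>u p $ k\<bar> \<le> C * (H + G)"
proof -
  obtain C where C: "C > 0" and bounds: "\<And>u g h N H G. \<lbrakk>u \<in> BC Strip; g \<in> BC Strip;
      \<And>p k. p \<in> Strip \<Longrightarrow> \<bar>u p $ k\<bar> \<le> \<mu> * N; \<And>t k. \<bar>z_trace m u t $ k\<bar> \<le> \<kappa> * N;
      \<And>t k. \<bar>apply_bcontfun h t $ k\<bar> \<le> H; \<And>p k. p \<in> Strip \<Longrightarrow> \<bar>g p $ k / a p $ k\<bar> \<le> G\<rbrakk> \<Longrightarrow>
      (\<forall>p\<in>Strip. \<forall>j. \<bar>\<Phi> g h u p $ j\<bar> \<le> \<theta> * N * \<mu> + C * (H + G)) \<and>
      (\<forall>t j. \<bar>z_trace m (\<Phi> g h u) t $ j\<bar> \<le> \<theta> * N * \<kappa> + C * (H + G))"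
    using \<Phi>_bounds by blast
  \<comment> \<open>The sum of 1/\<mu> and 1/\<kappa> replaces a maximum over the two parts of the
    norm, 1 - \<theta> comes from the absorption, and the outer \<mu> returns from N to u.\<close>
  define K where "K = \<mu> * ((1 / \<mu> + 1 / \<kappa>) * C / (1 - \<theta>))"
  have "K > 0" unfolding K_def using \<mu> \<kappa> \<theta> C by (intro mult_pos_pos divide_pos_pos add_pos_pos) auto
  moreover have "\<bar>u p $ k\<bar> \<le> K * (H + G)"
    if u: "u \<in> BC Strip" and g: "g \<in> BC Strip" and eq: "\<And>p. p \<in> Strip \<Longrightarrow> u p = \<Phi> g h u p"
      and H: "\<And>t k. \<bar>apply_bcontfun h t $ k\<bar> \<le> H"
      and G: "\<And>p k. p \<in> Strip \<Longrightarrow> \<bar>g p $ k / a p $ k\<bar> \<le> G" and p: "p \<in> Strip" for u g h H G p k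
  proof -
    define U where "U = BC_norm Strip u"
    define Z where "Z = BC_norm UNIV (z_trace m u)"
    define N where "N = max (U / \<mu>) (Z / \<kappa>)"
    let ?F = "C * (H + G)"
    have UN: "U \<le> \<mu> * N" and ZN: "Z \<le> \<kappa> * N"
      using \<mu> \<kappa> by (auto simp: N_def max_def field_simps)
    have u_le: "\<bar>u p $ k\<bar> \<le> \<mu> * N" if "p \<in> Strip" for p k
      using BC_norm_upper[OF u that, of k] UN by (simp add: U_def)
    have z_le: "\<bar>z_trace m u t $ k\<bar> \<le> \<kappa> * N" for t k
      using BC_norm_upper[OF z_trace_BC[OF u] UNIV_I, of m t k] ZN by (simp add: Z_def)
    have tr: "z_trace m (\<Phi> g h u) = z_trace m u" by (rule z_trace_cong) (simp add: eq)
    note B = bounds[OF u g u_le z_le H G]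
    have "U \<le> \<theta> * N * \<mu> + ?F"
      unfolding U_def by (rule BC_norm_least[OF Strip_nonempty]) (use B eq in auto)
    then have 1: "U / \<mu> \<le> \<theta> * N + ?F / \<mu>" using \<mu> by (simp add: field_simps)
    have "Z \<le> \<theta> * N * \<kappa> + ?F"
      unfolding Z_def by (rule BC_norm_least) (use B tr in auto)
    then have 2: "Z / \<kappa> \<le> \<theta> * N + ?F / \<kappa>" using \<kappa> by (simp add: field_simps)
    have "0 \<le> H" by (rule order.trans[OF abs_ge_zero H[of 0 undefined]])
    moreover have "0 \<le> G" by (rule order.trans[OF abs_ge_zero G[OF p, of undefined]])
    ultimately have "0 \<le> ?F / \<mu>" "0 \<le> ?F / \<kappa>" using C \<mu> \<kappa> by simp_all
    with 1 2 have "N \<le> \<theta> * N + (?F / \<mu> + ?F / \<kappa>)" unfolding N_def by linarith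
    then have "(1 - \<theta>) * N \<le> (1 / \<mu> + 1 / \<kappa>) * ?F"
      unfolding distrib_right left_diff_distrib by simp
    then have "N \<le> (1 / \<mu> + 1 / \<kappa>) * ?F / (1 - \<theta>)" using \<theta> by (simp add: pos_le_divide_eq mult.commute)
    then have "\<mu> * N \<le> \<mu> * ((1 / \<mu> + 1 / \<kappa>) * ?F / (1 - \<theta>))" using \<mu> by (intro mult_left_mono) auto
    also have "\<dots> = K * (H + G)" by (simp add: K_def)
    finally show ?thesis using u_le[OF p, of k] by linarith
  qed
  ultimately show ?thesis by (rule that)
qed

lemma \<Phi>_fixpoint_exists:
  assumes g: "g \<in> BC Strip"
  shows "\<exists>u\<in>BC Strip. \<forall>p\<in>Strip. u p = \<Phi> g h u p"
proof -
  obtain C where C: "C > 0" and bounds: "\<And>u g h N H G. \<lbrakk>u \<in> BC Strip; g \<in> BC Strip;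
      \<And>p k. p \<in> Strip \<Longrightarrow> \<bar>u p $ k\<bar> \<le> \<mu> * N; \<And>t k. \<bar>z_trace m u t $ k\<bar> \<le> \<kappa> * N;
      \<And>t k. \<bar>apply_bcontfun h t $ k\<bar> \<le> H; \<And>p k. p \<in> Strip \<Longrightarrow> \<bar>g p $ k / a p $ k\<bar> \<le> G\<rbrakk> \<Longrightarrow>
      (\<forall>p\<in>Strip. \<forall>j. \<bar>\<Phi> g h u p $ j\<bar> \<le> \<theta> * N * \<mu> + C * (H + G)) \<and>
      (\<forall>t j. \<bar>z_trace m (\<Phi> g h u) t $ j\<bar> \<le> \<theta> * N * \<kappa> + C * (H + G))"
    using \<Phi>_bounds by blast
  \<comment> \<open>Functions on the strip are extended constantly in \<open>x\<close> to work in a complete function type.\<close>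
  define cl :: "real \<times> real \<Rightarrow> real \<times> real" where "cl p = (max 0 (min 1 (fst p)), snd p)" for p
  have cl: "cl p \<in> Strip" for p by (simp add: cl_def Strip_def)
  have cl_id: "cl p = p" if "p \<in> Strip" for p using that by (auto simp: cl_def Strip_def)
  have cl_cont: "continuous_on UNIV cl" unfolding cl_def by (intro continuous_intros)
  have ext: "(\<lambda>p. w (cl p)) \<in> BC UNIV" if w: "w \<in> BC Strip" for w :: "'n vec_field"
  proof -
    obtain B where "\<And>p. p \<in> Strip \<Longrightarrow> norm (w p) \<le> B" using BC_bound[OF w] by metis
    then show ?thesis
      by (intro BC_I[where B=B] continuous_on_compose2[OF BC_continuous[OF w] cl_cont]) (use cl in auto)
  qed
  define F where "F w = Bcontfun (\<lambda>p. \<Phi> g h (apply_bcontfun w) (cl p))" for w :: "(real \<times> real) \<Rightarrow>\<^sub>C (real, 'n) vec"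
  have F: "apply_bcontfun (F w) p = \<Phi> g h (apply_bcontfun w) (cl p)" for w p
    unfolding F_def by (subst Bcontfun_inverse_BC[OF ext[OF \<Phi>_BC[OF bcontfun_BC g]]]) simp
  \<comment> \<open>The supremum of the first part is over the whole plane: elements of the type
    need not be constant extensions, and N has to control their full norm.\<close>
  define N where "N w = max (BC_norm UNIV (apply_bcontfun w) / \<mu>) (BC_norm UNIV (z_trace m (apply_bcontfun w)) / \<kappa>)"
    for w :: "(real \<times> real) \<Rightarrow>\<^sub>C (real, 'n) vec"
  have UN: "BC_norm UNIV (apply_bcontfun w) \<le> \<mu> * N w"
    and ZN: "BC_norm UNIV (z_trace m (apply_bcontfun w)) \<le> \<kappa> * N w" for w
    using \<mu> \<kappa> by (auto simp: N_def max_def field_simps)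
  have "\<exists>w. F w = w"
  proof (rule weighted_contraction_fixpoint[where N=N and \<theta>=\<theta>
        and C="1 / \<mu> + 1 / \<kappa>" and D="real CARD('n) * \<mu>"])
    fix w :: "(real \<times> real) \<Rightarrow>\<^sub>C (real, 'n) vec"
    have "BC_norm UNIV (z_trace m (apply_bcontfun w)) \<le> norm w"
      by (rule BC_norm_least)
         (auto simp: z_trace_def intro: order.trans[OF component_le_norm_cart norm_bounded])
    then have "BC_norm UNIV (apply_bcontfun w) / \<mu> \<le> norm w / \<mu>"
      "BC_norm UNIV (z_trace m (apply_bcontfun w)) / \<kappa> \<le> norm w / \<kappa>"
      using BC_norm_le_norm[of w] \<mu> \<kappa> by (auto intro!: divide_right_mono)
    moreover have "0 \<le> norm w / \<mu>" "0 \<le> norm w / \<kappa>" using \<mu> \<kappa> by auto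
    ultimately have "N w \<le> norm w / \<mu> + norm w / \<kappa>" unfolding N_def by linarith
    then show "N w \<le> (1 / \<mu> + 1 / \<kappa>) * norm w" by (simp add: algebra_simps)
    have "norm w \<le> real CARD('n) * BC_norm UNIV (apply_bcontfun w)" by (rule norm_le_BC_norm)
    also have "\<dots> \<le> real CARD('n) * (\<mu> * N w)" by (intro mult_left_mono UN) auto
    finally show "norm w \<le> real CARD('n) * \<mu> * N w" by simp
  next
    fix v w :: "(real \<times> real) \<Rightarrow>\<^sub>C (real, 'n) vec"
    \<comment> \<open>Data cancel in a difference of images, so \<open>bounds\<close> is used with
      zero data and leaves the factor \<theta> alone.\<close>
    define \<delta> where "\<delta> = \<Phi> (\<lambda>_. 0) 0 (apply_bcontfun (v - w))"
    have \<delta>: "\<Phi> g h (apply_bcontfun v) p - \<Phi> g h (apply_bcontfun w) p = \<delta> p" if "p \<in> Strip" for p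
      using \<Phi>_diff[where u="apply_bcontfun v" and v="apply_bcontfun w" and h=h and h'=h, OF bcontfun_BC bcontfun_BC g g that]
      by (simp add: \<delta>_def minus_bcontfun.rep_eq[abs_def])
    have B: "(\<forall>p\<in>Strip. \<forall>j. \<bar>\<delta> p $ j\<bar> \<le> \<theta> * N (v - w) * \<mu> + C * (0 + 0)) \<and>
      (\<forall>t j. \<bar>z_trace m \<delta> t $ j\<bar> \<le> \<theta> * N (v - w) * \<kappa> + C * (0 + 0))"
      unfolding \<delta>_def
    proof (rule bounds[OF bcontfun_BC BC_const])
      show "\<bar>apply_bcontfun (v - w) p $ k\<bar> \<le> \<mu> * N (v - w)" for p k
        by (rule order.trans[OF BC_norm_upper[OF bcontfun_BC UNIV_I] UN])
      show "\<bar>z_trace m (apply_bcontfun (v - w)) t $ k\<bar> \<le> \<kappa> * N (v - w)" for t k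
        by (rule order.trans[OF BC_norm_upper[OF z_trace_BC[OF bcontfun_BC] UNIV_I] ZN])
    qed (auto simp: zero_bcontfun.rep_eq)
    have FF: "apply_bcontfun (F v - F w) p = \<delta> (cl p)" for p
      by (simp add: minus_bcontfun.rep_eq F \<delta>[OF cl])
    have "BC_norm UNIV (apply_bcontfun (F v - F w)) \<le> \<theta> * N (v - w) * \<mu>"
      by (rule BC_norm_least, simp, unfold FF) (use B cl in auto)
    moreover have "z_trace m (apply_bcontfun (F v - F w)) = z_trace m \<delta>"
      by (rule z_trace_cong) (simp only: FF cl_id)
    then have "BC_norm UNIV (z_trace m (apply_bcontfun (F v - F w))) \<le> \<theta> * N (v - w) * \<kappa>"
      by (intro BC_norm_least) (use B in auto)
    ultimately show "N (F v - F w) \<le> \<theta> * N (v - w)"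
      unfolding N_def[of "F v - F w"] using \<mu> \<kappa> by (simp add: pos_divide_le_eq)
  qed (use \<mu> \<kappa> \<theta> in \<open>auto intro!: add_pos_pos\<close>)
  then obtain w where w: "F w = w" by blast
  have "apply_bcontfun w p = \<Phi> g h (apply_bcontfun w) p" if "p \<in> Strip" for p
    using F[of w p] by (simp add: w cl_id[OF that])
  then show ?thesis using bcontfun_BC by blast
qed

end

section \<open>The linear boundary value problem\<close>

lemma BC_matrix_vector_bound:
  fixes A :: "'a::topological_space \<Rightarrow> real ^ 'm ^ 'n"
  assumes "A \<in> BC S"
  obtains Q where "Q > 0" "\<And>p w B j. p \<in> S \<Longrightarrow> (\<And>k. \<bar>w $ k\<bar> \<le> B) \<Longrightarrow> \<bar>(A p *v w) $ j\<bar> \<le> Q * B"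
proof -
  obtain Q where Q: "Q > 0" "\<And>p. p \<in> S \<Longrightarrow> norm (A p) \<le> Q" using BC_bound[OF assms] by metis
  have "\<bar>(A p *v w) $ j\<bar> \<le> (real CARD('m) * Q) * B" if p: "p \<in> S" and w: "\<And>k. \<bar>w $ k\<bar> \<le> B" for p w B j
  proof -
    have "\<bar>(A p *v w) $ j\<bar> \<le> (\<Sum>k\<in>UNIV. \<bar>A p $ j $ k * w $ k\<bar>)"
      unfolding matrix_vector_mult_def by (simp add: sum_abs)
    also have "\<dots> \<le> real CARD('m) * (Q * B)"
    proof (rule sum_bounded_above)
      fix k
      have "\<bar>A p $ j $ k\<bar> \<le> Q"
        by (rule order.trans[OF component_le_norm_cart])
           (rule order.trans[OF Finite_Cartesian_Product.norm_nth_le Q(2)[OF p]])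
      then show "\<bar>A p $ j $ k * w $ k\<bar> \<le> Q * B"
        unfolding abs_mult using w[of k] Q(1) by (intro mult_mono) auto
    qed
    finally show ?thesis by (simp add: mult.assoc)
  qed
  moreover have "real CARD('m) * Q > 0" using Q(1) by simp
  ultimately show ?thesis by (rule that[rotated])
qed

section \<open>Reduction of the original problem to the diagonal system\<close>

lemma (in hyperbolic_problem) bc_solution_iff:
  assumes "b = diag_b astar bstar q"
  shows "bc_solution m R astar bstar q a g h v \<longleftrightarrow> v \<in> BC Strip \<and>
    (\<forall>p\<in>Strip. matrix_inv (q p) *v v p = \<Phi> (\<lambda>p. matrix_inv (q p) *v g p) h (\<lambda>p. matrix_inv (q p) *v v p) p)"
proof -
  have swap: "(\<forall>j. \<forall>(x, t)\<in>Strip. Q j x t) \<longleftrightarrow> (\<forall>p\<in>Strip. \<forall>j. Q j (fst p) (snd p))"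
    for Q :: "'n \<Rightarrow> real \<Rightarrow> real \<Rightarrow> bool"
    by fastforce
  show ?thesis
    unfolding bc_solution_def \<Phi>_def char_op_def source_def trace_bcf_def Let_def assms[symmetric]
      vec_eq_iff swap
    by simp
qed

lemma assumptions_L_system:
  fixes a :: "('n::{finite,linorder}) vec_field"
  assumes L: "assumptions_L m astar bstar q a"
  obtains l where "hyperbolic_system m a (diag_b astar bstar q) l"
    "q \<in> BC Strip" "(\<lambda>p. matrix_inv (q p)) \<in> BC Strip" "\<And>p. p \<in> Strip \<Longrightarrow> invertible (q p)"
proof -
  have astar: "\<And>j k. (\<lambda>p. astar p $ j $ k) \<in> BC1" and bstar: "\<And>j k. (\<lambda>p. bstar p $ j $ k) \<in> BC Strip"
    and q: "\<And>j k. (\<lambda>p. q p $ j $ k) \<in> BC1" and inv: "\<And>p. p \<in> Strip \<Longrightarrow> invertible (q p)"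
    and diag: "\<And>p. p \<in> Strip \<Longrightarrow> matrix_inv (q p) ** astar p ** q p = (\<chi> j k. if j = k then a p $ j else 0)"
    and pos: "\<And>p j. p \<in> Strip \<Longrightarrow> idx j \<le> m \<Longrightarrow> a p $ j > 0"
    and neg: "\<And>p j. p \<in> Strip \<Longrightarrow> idx j > m \<Longrightarrow> a p $ j < 0"
    using L unfolding assumptions_L_def by blast+
  obtain l where l: "l > 0" "\<And>j. idx j \<le> m \<Longrightarrow> (INF p\<in>Strip. a p $ j) > l"
    "\<And>j. idx j > m \<Longrightarrow> (SUP p\<in>Strip. a p $ j) < - l" "(INF p\<in>Strip. \<bar>det (q p)\<bar>) > l"
    using L unfolding assumptions_L_def by blast
  have det: "l \<le> \<bar>det (q p)\<bar>" if "p \<in> Strip" for p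
    using cINF_lower[of "\<lambda>p. \<bar>det (q p)\<bar>" Strip p] that l(4) by (force intro: bdd_belowI2[where m=0])
  have away: "l \<le> \<bar>a p $ j\<bar>" if p: "p \<in> Strip" for p j
  proof (cases "idx j \<le> m")
    case True
    \<comment> \<open>The sign of a_j supplies the bound that makes the infimum genuine.\<close>
    have "bdd_below ((\<lambda>p. a p $ j) ` Strip)"
      by (rule bdd_belowI2[where m=0]) (use pos True in \<open>auto intro: less_imp_le\<close>)
    from cINF_lower[OF this p] show ?thesis using l(2)[OF True] by linarith
  next
    case False
    have "bdd_above ((\<lambda>p. a p $ j) ` Strip)"
      by (rule bdd_aboveI2[where M=0]) (use neg False in \<open>auto intro: less_imp_le\<close>)
    from cSUP_upper[OF p this] show ?thesis using l(3)[of j] False by linarith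
  qed
  have qi: "(\<lambda>p. matrix_inv (q p) $ j $ k) \<in> BC_Lip" for j k
    by (rule BC_Lip_matrix_inv[OF BC1_BC_Lip[OF q] inv l(1) det])
  have a_Lip: "(\<lambda>p. a p $ j) \<in> BC_Lip" for j
  proof (rule BC_Lip_cong)
    \<comment> \<open>On the strip the eigenvalue is a diagonal entry of this product, whose factors
      all have Lipschitz entries.\<close>
    show "(\<lambda>p. (matrix_inv (q p) ** astar p ** q p) $ j $ j) \<in> BC_Lip"
      unfolding matrix_matrix_mult_def
      by (simp, intro BC_Lip_sum BC_Lip_mult qi BC1_BC_Lip astar q)
  qed (simp add: diag)
  have entries: "A \<in> BC Strip" if "\<And>j k. (\<lambda>p. A p $ j $ k) \<in> BC Strip" for A :: "'n mat_field"
    using that by (simp add: BC_vec_iff)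
  have q_BC: "q \<in> BC Strip" by (rule entries) (rule BC_Lip_BC[OF BC1_BC_Lip[OF q]])
  have qi_BC: "(\<lambda>p. matrix_inv (q p)) \<in> BC Strip" by (rule entries) (rule BC_Lip_BC[OF qi])
  have a_BC: "astar \<in> BC Strip" by (rule entries) (rule BC_Lip_BC[OF BC1_BC_Lip[OF astar]])
  have b_BC: "bstar \<in> BC Strip" by (rule entries) (rule bstar)
  have pd_t: "pd_t q \<in> BC Strip"
  proof (rule entries)
    show "(\<lambda>p. pd_t q p $ j $ k) \<in> BC Strip" for j k
      by (rule BC_cong[of "pd_t (\<lambda>p. q p $ j $ k)"]) (use q[of j k] in \<open>auto simp: BC1_def pd_t_entry[OF q]\<close>)
  qed
  have pd_x: "pd_x q \<in> BC Strip"
  proof (rule entries)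
    show "(\<lambda>p. pd_x q p $ j $ k) \<in> BC Strip" for j k
      by (rule BC_cong[of "pd_x (\<lambda>p. q p $ j $ k)"]) (use q[of j k] in \<open>auto simp: BC1_def pd_x_entry[OF q]\<close>)
  qed
  have "diag_b astar bstar q \<in> BC Strip"
    unfolding diag_b_def[abs_def]
    by (intro BC_matrix_matrix_mult BC_add q_BC qi_BC a_BC b_BC pd_t pd_x)
  then have "hyperbolic_system m a (diag_b astar bstar q) l"
    by unfold_locales (use a_Lip l(1) away pos neg in auto)
  with q_BC qi_BC inv show ?thesis using that by blast
qed

theorem theorem2p1:
  fixes R :: "('n::{finite,linorder}) BC_op"
    and astar bstar q :: "'n mat_field"
    and a :: "'n vec_field"
    and m :: nat
  assumes "assumptions_L m astar bstar q a"
    and "cond_B1 R a (diag_b astar bstar q) \<or> cond_B2 R a (diag_b astar bstar q)"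
  shows "(\<forall>g h. g \<in> BC Strip \<longrightarrow>
            (\<exists>v. bc_solution m R astar bstar q a g h v \<and>
               (\<forall>w. bc_solution m R astar bstar q a g h w \<longrightarrow> (\<forall>p \<in> Strip. w p = v p)))) \<and>
         (\<exists>K > 0. \<forall>g h v. g \<in> BC Strip \<longrightarrow> bc_solution m R astar bstar q a g h v \<longrightarrow>
            BC_norm Strip v \<le> K * (BC_norm Strip g + BC_norm UNIV (apply_bcontfun h)))"
proof -
  let ?b = "diag_b astar bstar q" and ?qi = "\<lambda>w p. matrix_inv (q p) *v w p"
  obtain l where sys: "hyperbolic_system m a ?b l" and q: "q \<in> BC Strip"
    and qi: "(\<lambda>p. matrix_inv (q p)) \<in> BC Strip" and inv: "\<And>p. p \<in> Strip \<Longrightarrow> invertible (q p)"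
    using assumptions_L_system[OF assms(1)] by metis
  interpret hyperbolic_system m a ?b l by (rule sys)
  obtain \<mu> \<kappa> \<theta> where "hyperbolic_problem m a ?b l R \<mu> \<kappa> \<theta>"
    using weights[OF assms(2)] hyperbolic_problem.intro[OF sys] hyperbolic_problem_axioms.intro by metis
  then interpret hyperbolic_problem m a ?b l R \<mu> \<kappa> \<theta> .
  note sol = bc_solution_iff[OF refl]
  have qi_BC: "?qi w \<in> BC Strip" if "w \<in> BC Strip" for w by (rule BC_matrix_vector_mult[OF qi that])
  have q_qi: "q p *v ?qi w p = w p" if "p \<in> Strip" for p and w :: "'n vec_field"
    by (simp add: matrix_vector_mul_assoc matrix_inv_cancel(1)[OF inv[OF that]])
  obtain C where C: "C > 0" and apriori: "\<And>u g h H G p k. \<lbrakk>u \<in> BC Strip; g \<in> BC Strip;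
      \<And>p. p \<in> Strip \<Longrightarrow> u p = \<Phi> g h u p; \<And>t k. \<bar>apply_bcontfun h t $ k\<bar> \<le> H;
      \<And>p k. p \<in> Strip \<Longrightarrow> \<bar>g p $ k / a p $ k\<bar> \<le> G; p \<in> Strip\<rbrakk> \<Longrightarrow> \<bar>u p $ k\<bar> \<le> C * (H + G)"
    using \<Phi>_apriori by blast
  have existence: "\<exists>v. bc_solution m R astar bstar q a g h v" if g: "g \<in> BC Strip" for g h
  proof -
    obtain u where u: "u \<in> BC Strip" and eq: "\<And>p. p \<in> Strip \<Longrightarrow> u p = \<Phi> (?qi g) h u p"
      using \<Phi>_fixpoint_exists[OF qi_BC[OF g]] by blast
    \<comment> \<open>v is recovered from the fixed point u. Off the strip \<open>q p\<close> may be
      singular, so u and the transform of v are compared on the strip only.\<close>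
    let ?v = "\<lambda>p. q p *v u p"
    have uv: "?qi ?v p = u p" if "p \<in> Strip" for p
      by (simp add: matrix_vector_mul_assoc matrix_inv_cancel(2)[OF inv[OF that]])
    have trace: "z_trace m (?qi ?v) = z_trace m u" by (rule z_trace_cong[OF uv])
    have "\<Phi> (?qi g) h (?qi ?v) p = \<Phi> (?qi g) h u p" if "p \<in> Strip" for p
      unfolding \<Phi>_def trace_bcf_def trace by (rule char_op_cong[OF uv refl that])
    then have "bc_solution m R astar bstar q a g h ?v"
      unfolding sol using uv eq BC_matrix_vector_mult[OF q u] by simp
    then show ?thesis by blast
  qed
  have uniqueness: "w p = v p" if g: "g \<in> BC Strip" and v: "bc_solution m R astar bstar q a g h v"
    and w: "bc_solution m R astar bstar q a g h w" and p: "p \<in> Strip" for g h v w p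
  proof -
    have vw: "?qi v \<in> BC Strip" "?qi w \<in> BC Strip" using v w by (auto simp: sol qi_BC)
    \<comment> \<open>The difference of two solutions solves the problem with zero data, for which
      the a priori bound is 0.\<close>
    have "\<bar>(?qi w p - ?qi v p) $ k\<bar> \<le> C * (0 + 0)" for k
    proof (rule apriori[where h="h - h" and g="\<lambda>p. ?qi g p - ?qi g p" and u="\<lambda>p. ?qi w p - ?qi v p"])
      show "?qi w p - ?qi v p = \<Phi> (\<lambda>p. ?qi g p - ?qi g p) (h - h) (\<lambda>p. ?qi w p - ?qi v p) p"
        if "p \<in> Strip" for p
        unfolding \<Phi>_diff[OF vw(2,1) qi_BC[OF g] qi_BC[OF g] that] using v w that by (simp add: sol)
      show "(\<lambda>p. ?qi w p - ?qi v p) \<in> BC Strip" by (rule BC_diff[OF vw(2,1)])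
      show "(\<lambda>p. ?qi g p - ?qi g p) \<in> BC Strip" by (rule BC_diff[OF qi_BC[OF g] qi_BC[OF g]])
    qed (simp_all add: p zero_bcontfun.rep_eq)
    then have "(?qi w p - ?qi v p) $ k = 0" for k by simp
    then have "?qi w p = ?qi v p" unfolding vec_eq_iff vector_minus_component by simp
    then have "q p *v ?qi w p = q p *v ?qi v p" by (rule arg_cong)
    then show ?thesis unfolding q_qi[OF p] .
  qed
  obtain Q where Q: "Q > 0" "\<And>p w B j. p \<in> Strip \<Longrightarrow> (\<And>k. \<bar>w $ k\<bar> \<le> B) \<Longrightarrow> \<bar>(q p *v w) $ j\<bar> \<le> Q * B"
    using BC_matrix_vector_bound[OF q] by blast
  obtain P where P: "P > 0" "\<And>p w B j. p \<in> Strip \<Longrightarrow> (\<And>k. \<bar>w $ k\<bar> \<le> B) \<Longrightarrow> \<bar>(matrix_inv (q p) *v w) $ j\<bar> \<le> P * B"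
    using BC_matrix_vector_bound[OF qi] by blast
  \<comment> \<open>Q accounts for the passage from u back to v = q u, P for applying the inverse of
    q to g, and 1/l for dividing by a_j.\<close>
  let ?K = "Q * (C * (1 + P / l))"
  have estimate: "BC_norm Strip v \<le> ?K * (BC_norm Strip g + BC_norm UNIV (apply_bcontfun h))"
    if g: "g \<in> BC Strip" and v: "bc_solution m R astar bstar q a g h v" for g h v
  proof (rule BC_norm_least[OF Strip_nonempty])
    fix p :: "real \<times> real" and j assume p: "p \<in> Strip"
    let ?g = "BC_norm Strip g" and ?h = "BC_norm UNIV (apply_bcontfun h)"
    have nonneg: "0 \<le> ?g" "0 \<le> ?h"
      by (auto intro!: BC_norm_nonneg g Strip_nonempty bcontfun_BC)
    have "\<bar>?qi v p $ k\<bar> \<le> C * (?h + P * ?g / l)" for k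
    proof (rule apriori[where h=h and g="?qi g" and u="?qi v"])
      show "\<bar>apply_bcontfun h t $ k\<bar> \<le> ?h" for t k by (rule BC_norm_upper[OF bcontfun_BC UNIV_I])
      show "\<bar>?qi g p $ k / a p $ k\<bar> \<le> P * ?g / l" if "p \<in> Strip" for p k
        unfolding abs_divide
        using P(1) nonneg(1) l_pos by (intro frac_le P(2) that BC_norm_upper g a_away) auto
    qed (use v g p in \<open>auto simp: sol qi_BC\<close>)
    also have "C * (?h + P * ?g / l) \<le> C * ((1 + P / l) * (?g + ?h))"
    proof (rule mult_left_mono)
      have "0 \<le> P / l * ?h" using P(1) l_pos nonneg(2) by simp
      then show "?h + P * ?g / l \<le> (1 + P / l) * (?g + ?h)"
        using nonneg(1) by (simp add: distrib_left distrib_right)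
    qed (use C in auto)
    finally have "\<bar>?qi v p $ k\<bar> \<le> C * ((1 + P / l) * (?g + ?h))" for k .
    from Q(2)[OF p this, of j] show "\<bar>v p $ j\<bar> \<le> ?K * (?g + ?h)"
      unfolding q_qi[OF p] by (simp add: mult.assoc)
  qed
  have "?K > 0" using Q(1) C P(1) l_pos by (intro mult_pos_pos add_pos_pos divide_pos_pos) auto
  with existence uniqueness estimate show ?thesis by blast
qed

end
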